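(* Let $\Sigma=(\Sigma_c,\Sigma_r)$ and $\Delta=(\Delta_c,\Delta_r)$ be structured alphabets and let $\Sigma_\bot=(\Sigma_c\cup\{\bot_c\},\Sigma_r\cup\{\bot_r\})$ where $\bot_c,\bot_r$ are two fresh symbols. Well-nested visibly pushdown transducers from $\Sigma_\bot$ to $\Delta$ run on first-child next-sibling encodings are exactly as expressive as hedge-to-hedge transducers from $\Sigma_c\times\Sigma_r$ to $\Delta$. That is: (1) for every well-nested visibly pushdown transducer $A$ from $\Sigma_\bot$ to $\Delta$ that does not accept $\mathrm{fcns}(\epsilon)=\bot_c\bot_r$, there exists a hedge-to-hedge transducer $T$ from $\Sigma_c\times\Sigma_r$ to $\Delta$ that does not accept the empty hedge, such that $A\circ\mathrm{fcns}=T\circ\mathrm{hedge}$ (as relations between $\mathcal W_\Sigma$ and $\Delta^*$); and (2) for every hedge-to-hedge transducer $T$ from $\Sigma_c\times\Sigma_r$ to $\Delta$ that does not accept the empty hedge, there exists a well-nested visibly pushdown transducer $A$ from $\Sigma_\bot$ to $\Delta$ that does not accept $\bot_c\bot_r$, such that $A\circ\mathrm{fcns}=T\circ\mathrm{hedge}$.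
   Context: **Well-nested words.** A structured alphabet is a pair $\Sigma=(\Sigma_c,\Sigma_r)$ of disjoint finite alphabets (call and return symbols), identified with $\Sigma_c\cup\Sigma_r$. The set $\mathcal W_\Sigma$ of well-nested words is the least set of words over $\Sigma$ containing the empty word $\epsilon$, closed under concatenation, and such that $cwr\in\mathcal W_\Sigma$ whenever $w\in\mathcal W_\Sigma$, $c\in\Sigma_c$, $r\in\Sigma_r$. Every nonempty $w\in\mathcal W_\Sigma$ decomposes uniquely as $w=cw_1rw_2$ with $c\in\Sigma_c$, $r\in\Sigma_r$, $w_1,w_2\in\mathcal W_\Sigma$. **First-child next-sibling encoding.** The map $\mathrm{fcns}:\mathcal W_\Sigma\to\mathcal W_{\Sigma_\bot}$ is defined by $\mathrm{fcns}(\epsilon)=\bot_c\bot_r$ and $\mathrm{fcns}(cw_1rw_2)=c\,\mathrm{fcns}(w_1)\,\mathrm{fcns}(w_2)\,r$. **Hedges.** For a finite alphabet $\Lambda$, the set $\mathcal H_\Lambda$ of hedges over $\Lambda$ is the set of finite ordered sequences of unranked ordered $\Lambda$-labelled trees: a hedge is either the empty hedge $0$ or is uniquely of the form $f(h_1)\cdot h_2$ with $f\in\Lambda$ and $h_1,h_2\in\mathcal H_\Lambda$ (here $\cdot$ is associative concatenation with unit $0$). The map $\mathrm{hedge}:\mathcal W_\Sigma\to\mathcal H_{\Sigma_c\times\Sigma_r}$ is defined by $\mathrm{hedge}(\epsilon)=0$ and $\mathrm{hedge}(cw_1rw_2)=(c,r)(\mathrm{hedge}(w_1))\cdot\mathrm{hedge}(w_2)$.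 **Visibly pushdown transducers.** A visibly pushdown transducer from a structured alphabet $\Sigma$ to $\Delta$ (applied in the claim with $\Sigma_\bot$ in place of $\Sigma$) is a tuple $A=(Q,I,F,\Gamma,\delta)$ with $Q$ a finite set of states, $I,F\subseteq Q$ the initial and final states, $\Gamma$ a finite stack alphabet, $\bot\notin\Gamma$ the bottom stack symbol, and $\delta=\delta_c\uplus\delta_r$ finite, where $\delta_c\subseteq Q\times\Sigma_c\times\Gamma\times\Delta^*\times Q$ (call transitions) and $\delta_r\subseteq Q\times\Sigma_r\times\Gamma\times\Delta^*\times Q$ (return transitions). A configuration is a pair $(q,\sigma)$ with $q\in Q$, $\sigma\in\bot\Gamma^*$. A call transition $(q,a,\gamma,v,q')$ reads $a$, outputs $v$, and goes from $(q,\sigma)$ to $(q',\sigma\gamma)$; a return transition $(q,a,\gamma,v,q')$ reads $a$, outputs $v$, and goes from $(q,\sigma\gamma)$ to $(q',\sigma)$. A run on a word is a sequence of transitions reading its letters in order; its output is the concatenation of the outputs of its transitions ($\epsilon$ for the empty run). A run is accepting if it goes from some $(q,\bot)$ with $q\in I$ to some $(q',\bot)$ with $q'\in F$. $A$ is identified with the relation of pairs $(u,v)$ such that there is an accepting run on $u$ with output $v$. For $\Delta$ structured, $A$ is well-nested if for all $\gamma\in\Gamma$ and all transitions $(q,c,\gamma,v,q')\in\delta_c$ and $(p,r,\gamma,v',p')\in\delta_r$, one has $vv'\in\mathcal W_\Delta$. **Hedge-to-string and hedge-to-hedge transducers.** A hedge-to-string transducer from $\Lambda$ to $\Delta$ is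 a tuple $T=(Q,I,\delta)$ with $Q$ a finite set of states, $I\subseteq Q$ the initial states, and $\delta$ a finite set of rules of the forms $$q(0)\to\epsilon,\qquad q(f(x_1)\cdot x_2)\to w_1q_1(x_1)w_2q_2(x_2)w_3,$$ with $q,q_1,q_2\in Q$, $f\in\Lambda$, $w_1,w_2,w_3\in\Delta^*$. Its semantics is given by maps $[\![q]\!]:\mathcal H_\Lambda\to 2^{\Delta^*}$: $[\![q]\!](0)=\{\epsilon\}$ if $q(0)\to\epsilon\in\delta$ and $\emptyset$ otherwise; $[\![q]\!](f(h)\cdot h')$ is the union, over all rules $q(f(x_1)\cdot x_2)\to w_1q_1(x_1)w_2q_2(x_2)w_3$ in $\delta$, of $w_1\cdot[\![q_1]\!](h)\cdot w_2\cdot[\![q_2]\!](h')\cdot w_3$. $T$ is identified with the relation $\{(h,s)\mid\exists q\in I,\ s\in[\![q]\!](h)\}$. For $\Delta$ structured, $T$ is a hedge-to-hedge transducer if $w_1w_2w_3\in\mathcal W_\Delta$ for every rule of the second form. A transducer accepts an input if the input is related to at least one output. $T\circ\mathrm{hedge}=\{(w,s)\mid w\in\mathcal W_\Sigma,\ (\mathrm{hedge}(w),s)\in T\}$ and $A\circ\mathrm{fcns}=\{(w,s)\mid w\in\mathcal W_\Sigma,\ (\mathrm{fcns}(w),s)\in A\}$. *)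

theory Defs
  imports Main
begin

section \<open>Structured alphabets and well-nested words\<close>

type_synonym 'a salphabet = "'a set \<times> 'a set"

abbreviation calls :: "'a salphabet \<Rightarrow> 'a set" where "calls \<Sigma> \<equiv> fst \<Sigma>"
abbreviation rets :: "'a salphabet \<Rightarrow> 'a set" where "rets \<Sigma> \<equiv> snd \<Sigma>"
abbreviation syms :: "'a salphabet \<Rightarrow> 'a set" where "syms \<Sigma> \<equiv> calls \<Sigma> \<union> rets \<Sigma>"

definition structured_alphabet :: "'a salphabet \<Rightarrow> bool" where
  "structured_alphabet \<Sigma> \<longleftrightarrow>
     finite (calls \<Sigma>) \<and> finite (rets \<Sigma>) \<and> calls \<Sigma> \<inter> rets \<Sigma> = {}"

definition bot_ext :: "'a salphabet \<Rightarrow> 'a \<Rightarrow> 'a \<Rightarrow> 'a salphabet" where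
  "bot_ext \<Sigma> bc br = (calls \<Sigma> \<union> {bc}, rets \<Sigma> \<union> {br})"

inductive_set well_nested :: "'a salphabet \<Rightarrow> 'a list set" for \<Sigma> where
  wn_Nil: "[] \<in> well_nested \<Sigma>"
| wn_append: "u \<in> well_nested \<Sigma> \<Longrightarrow> v \<in> well_nested \<Sigma> \<Longrightarrow> u @ v \<in> well_nested \<Sigma>"
| wn_wrap: "w \<in> well_nested \<Sigma> \<Longrightarrow> c \<in> calls \<Sigma> \<Longrightarrow> r \<in> rets \<Sigma> \<Longrightarrow> c # w @ [r] \<in> well_nested \<Sigma>"

lemma wn_node:
  assumes "w1 \<in> well_nested \<Sigma>" "w2 \<in> well_nested \<Sigma>" "c \<in> calls \<Sigma>" "r \<in> rets \<Sigma>"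
  shows "c # w1 @ r # w2 \<in> well_nested \<Sigma>"
  using wn_append[OF wn_wrap[OF assms(1,3,4)] assms(2)] by simp

lemma wn_decompose:
  assumes "w \<in> well_nested \<Sigma>" "w \<noteq> []"
  obtains c w1 r w2 where "c \<in> calls \<Sigma>" "r \<in> rets \<Sigma>"
    "w1 \<in> well_nested \<Sigma>" "w2 \<in> well_nested \<Sigma>" "w = c # w1 @ r # w2"
proof -
  have "w \<noteq> [] \<longrightarrow> (\<exists>c w1 r w2. c \<in> calls \<Sigma> \<and> r \<in> rets \<Sigma> \<and>
          w1 \<in> well_nested \<Sigma> \<and> w2 \<in> well_nested \<Sigma> \<and> w = c # w1 @ r # w2)"
    using assms(1)
  proof induction
    case (wn_append u v)
    show ?case
    proof (cases "u = []")
      case True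
      then show ?thesis using wn_append by simp
    next
      case False
      then obtain c w1 r w2 where "c \<in> calls \<Sigma>" "r \<in> rets \<Sigma>" "w1 \<in> well_nested \<Sigma>"
        "w2 \<in> well_nested \<Sigma>" "u = c # w1 @ r # w2"
        using wn_append.IH(1) by blast
      moreover have "w2 @ v \<in> well_nested \<Sigma>"
        using \<open>w2 \<in> well_nested \<Sigma>\<close> wn_append.hyps(2) by (rule well_nested.wn_append)
      ultimately show ?thesis
        by (intro impI exI[of _ c] exI[of _ w1] exI[of _ r] exI[of _ "w2 @ v"]) simp
    qed
  next
    case (wn_wrap w c r)
    then show ?case using wn_Nil by blast
  qed simp
  then show ?thesis using assms(2) that by blast
qed

definition height :: "'a salphabet \<Rightarrow> 'a list \<Rightarrow> int" where
  "height \<Sigma> w = (\<Sum>a\<leftarrow>w. if a \<in> calls \<Sigma> then 1 else - 1)"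

lemma height_simps [simp]:
  "height \<Sigma> [] = 0"
  "height \<Sigma> (a # w) = (if a \<in> calls \<Sigma> then 1 else - 1) + height \<Sigma> w"
  "height \<Sigma> (u @ v) = height \<Sigma> u + height \<Sigma> v"
  by (simp_all add: height_def)

lemma wn_height:
  assumes "calls \<Sigma> \<inter> rets \<Sigma> = {}" "w \<in> well_nested \<Sigma>"
  shows "height \<Sigma> w = 0 \<and> (\<forall>u v. w = u @ v \<longrightarrow> height \<Sigma> u \<ge> 0)"
  using assms(2)
proof induction
  case (wn_append x y)
  have "height \<Sigma> u \<ge> 0" if "x @ y = u @ v" for u v
    using that wn_append.IH by (auto simp: append_eq_append_conv2)
  then show ?case using wn_append.IH by auto
next
  case (wn_wrap w c r)
  have r: "r \<notin> calls \<Sigma>" using wn_wrap.hyps assms(1) by auto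
  have "height \<Sigma> u \<ge> 0" if eq: "c # w @ [r] = u @ v" for u v
  proof (cases u)
    case (Cons a u')
    then have "a = c" and "w @ [r] = u' @ v" using eq by auto
    then show ?thesis
      using Cons wn_wrap.IH wn_wrap.hyps r
      by (cases v rule: rev_cases) auto
  qed simp
  then show ?case using wn_wrap.IH wn_wrap.hyps r by simp
qed simp

lemma wn_decompose_unique:
  assumes disj: "calls \<Sigma> \<inter> rets \<Sigma> = {}"
    and "w1 \<in> well_nested \<Sigma>" "w1' \<in> well_nested \<Sigma>" "r \<in> rets \<Sigma>" "r' \<in> rets \<Sigma>"
    and eq: "c # w1 @ r # w2 = c' # w1' @ r' # w2'"
  shows "c = c' \<and> w1 = w1' \<and> r = r' \<and> w2 = w2'"
proof -
  have no: False
    if "x \<in> well_nested \<Sigma>" "y \<in> well_nested \<Sigma>" "y = x @ a # z" "a \<in> rets \<Sigma>" for x y z a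
  proof -
    have "y = (x @ [a]) @ z" using that(3) by simp
    then have "height \<Sigma> (x @ [a]) \<ge> 0" using wn_height[OF disj that(2)] by blast
    moreover have "a \<notin> calls \<Sigma>" using disj that(4) by auto
    ultimately show False using wn_height[OF disj that(1)] by simp
  qed
  from eq have "w1 @ r # w2 = w1' @ r' # w2'" by simp
  then consider us where "w1 = w1' @ us" "us @ r # w2 = r' # w2'"
    | us where "w1 @ us = w1'" "r # w2 = us @ r' # w2'"
    by (auto simp: append_eq_append_conv2)
  then have "w1 = w1'"
  proof cases
    case 1
    then show ?thesis
    proof (cases us)
      case (Cons a z)
      then have "a \<in> rets \<Sigma>" "w1 = w1' @ a # z" using 1 \<open>r' \<in> rets \<Sigma>\<close> by simp_all
      then show ?thesis using no \<open>w1 \<in> well_nested \<Sigma>\<close> \<open>w1' \<in> well_nested \<Sigma>\<close> by metis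
    qed simp
  next
    case 2
    then show ?thesis
    proof (cases us)
      case (Cons a z)
      then have "a \<in> rets \<Sigma>" "w1' = w1 @ a # z" using 2 \<open>r \<in> rets \<Sigma>\<close> by auto
      then show ?thesis using no \<open>w1 \<in> well_nested \<Sigma>\<close> \<open>w1' \<in> well_nested \<Sigma>\<close> by metis
    qed (use 2 in simp)
  qed
  then show ?thesis using eq by simp
qed

lemma wn_induct [consumes 1, case_names Nil node]:
  assumes "w \<in> well_nested \<Sigma>" "P []"
    and "\<And>c r w1 w2. c \<in> calls \<Sigma> \<Longrightarrow> r \<in> rets \<Sigma> \<Longrightarrow> w1 \<in> well_nested \<Sigma> \<Longrightarrow>
           w2 \<in> well_nested \<Sigma> \<Longrightarrow> P w1 \<Longrightarrow> P w2 \<Longrightarrow> P (c # w1 @ r # w2)"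
  shows "P w"
  using assms(1)
proof (induction w rule: length_induct)
  case (1 w)
  show ?case
  proof (cases "w = []")
    case False
    then obtain c w1 r w2 where w: "c \<in> calls \<Sigma>" "r \<in> rets \<Sigma>"
      "w1 \<in> well_nested \<Sigma>" "w2 \<in> well_nested \<Sigma>" "w = c # w1 @ r # w2"
      using wn_decompose 1 by metis
    then show ?thesis using 1 assms(3) by auto
  qed (use assms(2) in simp)
qed

section \<open>Recursion over the unique decomposition of well-nested words\<close>

inductive wn_fold_rel ::
  "'a salphabet \<Rightarrow> 'x \<Rightarrow> ('a \<Rightarrow> 'a \<Rightarrow> 'x \<Rightarrow> 'x \<Rightarrow> 'x) \<Rightarrow> 'a list \<Rightarrow> 'x \<Rightarrow> bool"
  for \<Sigma> e n where
  fold_Nil: "wn_fold_rel \<Sigma> e n [] e"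
| fold_node: "c \<in> calls \<Sigma> \<Longrightarrow> r \<in> rets \<Sigma> \<Longrightarrow> w1 \<in> well_nested \<Sigma> \<Longrightarrow> w2 \<in> well_nested \<Sigma> \<Longrightarrow>
   wn_fold_rel \<Sigma> e n w1 x1 \<Longrightarrow> wn_fold_rel \<Sigma> e n w2 x2 \<Longrightarrow>
   wn_fold_rel \<Sigma> e n (c # w1 @ r # w2) (n c r x1 x2)"

text \<open>Meaningful on well-nested words only; there it is characterised by
  \<open>wn_fold_Nil\<close> and \<open>wn_fold_node\<close>.\<close>

definition wn_fold ::
  "'a salphabet \<Rightarrow> 'x \<Rightarrow> ('a \<Rightarrow> 'a \<Rightarrow> 'x \<Rightarrow> 'x \<Rightarrow> 'x) \<Rightarrow> 'a list \<Rightarrow> 'x" where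
  "wn_fold \<Sigma> e n w = (THE x. wn_fold_rel \<Sigma> e n w x)"

lemma wn_fold_rel_functional:
  assumes disj: "calls \<Sigma> \<inter> rets \<Sigma> = {}"
  shows "wn_fold_rel \<Sigma> e n w x \<Longrightarrow> wn_fold_rel \<Sigma> e n w y \<Longrightarrow> x = y"
proof (induction arbitrary: y rule: wn_fold_rel.induct)
  case fold_Nil
  then show ?case by (cases rule: wn_fold_rel.cases) auto
next
  case (fold_node c r w1 w2 x1 x2)
  from fold_node.prems obtain c' r' w1' w2' x1' x2' where *:
    "c # w1 @ r # w2 = c' # w1' @ r' # w2'" "y = n c' r' x1' x2'"
    "r' \<in> rets \<Sigma>" "w1' \<in> well_nested \<Sigma>"
    "wn_fold_rel \<Sigma> e n w1' x1'" "wn_fold_rel \<Sigma> e n w2' x2'"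
    by (cases rule: wn_fold_rel.cases) blast
  have "c = c' \<and> w1 = w1' \<and> r = r' \<and> w2 = w2'"
    using wn_decompose_unique[OF disj fold_node.hyps(3) *(4) fold_node.hyps(2) *(3,1)] .
  then show ?case using * fold_node.IH by blast
qed

lemma wn_fold_rel_total:
  assumes "w \<in> well_nested \<Sigma>"
  shows "\<exists>x. wn_fold_rel \<Sigma> e n w x"
  using assms by (induction rule: wn_induct) (blast intro: wn_fold_rel.intros)+

lemma wn_fold_eqI:
  assumes "calls \<Sigma> \<inter> rets \<Sigma> = {}" "wn_fold_rel \<Sigma> e n w x"
  shows "wn_fold \<Sigma> e n w = x"
  unfolding wn_fold_def using assms wn_fold_rel_functional by (metis the_equality)

lemma wn_fold_Nil:
  assumes "structured_alphabet \<Sigma>"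
  shows "wn_fold \<Sigma> e n [] = e"
  using assms by (auto intro!: wn_fold_eqI wn_fold_rel.intros simp: structured_alphabet_def)

lemma wn_fold_node:
  assumes "structured_alphabet \<Sigma>" "c \<in> calls \<Sigma>" "r \<in> rets \<Sigma>"
    "w1 \<in> well_nested \<Sigma>" "w2 \<in> well_nested \<Sigma>"
  shows "wn_fold \<Sigma> e n (c # w1 @ r # w2) = n c r (wn_fold \<Sigma> e n w1) (wn_fold \<Sigma> e n w2)"
proof -
  have disj: "calls \<Sigma> \<inter> rets \<Sigma> = {}" using assms(1) by (simp add: structured_alphabet_def)
  obtain x1 x2 where x: "wn_fold_rel \<Sigma> e n w1 x1" "wn_fold_rel \<Sigma> e n w2 x2"
    using wn_fold_rel_total assms(4,5) by metis
  then have "wn_fold_rel \<Sigma> e n (c # w1 @ r # w2) (n c r x1 x2)"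
    using assms by (auto intro: wn_fold_rel.intros)
  then show ?thesis using wn_fold_eqI[OF disj] x by metis
qed

section \<open>First-child next-sibling encoding\<close>

definition fcns :: "'a salphabet \<Rightarrow> 'a \<Rightarrow> 'a \<Rightarrow> 'a list \<Rightarrow> 'a list" where
  "fcns \<Sigma> bc br = wn_fold \<Sigma> [bc, br] (\<lambda>c r x1 x2. c # x1 @ x2 @ [r])"

lemma fcns_Nil: "structured_alphabet \<Sigma> \<Longrightarrow> fcns \<Sigma> bc br [] = [bc, br]"
  by (simp add: fcns_def wn_fold_Nil)

lemma fcns_node:
  assumes "structured_alphabet \<Sigma>" "c \<in> calls \<Sigma>" "r \<in> rets \<Sigma>"
    "w1 \<in> well_nested \<Sigma>" "w2 \<in> well_nested \<Sigma>"
  shows "fcns \<Sigma> bc br (c # w1 @ r # w2) = c # fcns \<Sigma> bc br w1 @ fcns \<Sigma> bc br w2 @ [r]"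
  using assms by (simp add: fcns_def wn_fold_node)

lemma fcns_well_nested:
  assumes "structured_alphabet \<Sigma>" "w \<in> well_nested \<Sigma>"
  shows "fcns \<Sigma> bc br w \<in> well_nested (bot_ext \<Sigma> bc br)"
  using assms(2)
proof (induction rule: wn_induct)
  case Nil
  show ?case using wn_wrap[OF wn_Nil, of bc "bot_ext \<Sigma> bc br" br]
    by (simp add: fcns_Nil[OF assms(1)] bot_ext_def)
next
  case (node c r w1 w2)
  then show ?case
    using wn_wrap[OF wn_append[OF node.IH], of c r]
    by (simp add: fcns_node[OF assms(1)] bot_ext_def)
qed

section \<open>Hedges\<close>

datatype 'f tree = Tree 'f "'f tree list"

type_synonym 'f hedge = "'f tree list"

text \<open>The empty hedge is \<open>[]\<close>, and \<open>f(h\<^sub>1) \<cdot> h\<^sub>2\<close> is \<open>Tree f h\<^sub>1 # h\<^sub>2\<close>.\<close>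

definition hedges :: "'f set \<Rightarrow> 'f hedge set" where
  "hedges \<Lambda> = {h. \<forall>t\<in>set h. set_tree t \<subseteq> \<Lambda>}"

definition hedge :: "'a salphabet \<Rightarrow> 'a list \<Rightarrow> ('a \<times> 'a) hedge" where
  "hedge \<Sigma> = wn_fold \<Sigma> [] (\<lambda>c r h1 h2. Tree (c, r) h1 # h2)"

lemma hedge_Nil: "structured_alphabet \<Sigma> \<Longrightarrow> hedge \<Sigma> [] = []"
  by (simp add: hedge_def wn_fold_Nil)

lemma hedge_node:
  assumes "structured_alphabet \<Sigma>" "c \<in> calls \<Sigma>" "r \<in> rets \<Sigma>"
    "w1 \<in> well_nested \<Sigma>" "w2 \<in> well_nested \<Sigma>"
  shows "hedge \<Sigma> (c # w1 @ r # w2) = Tree (c, r) (hedge \<Sigma> w1) # hedge \<Sigma> w2"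
  using assms by (simp add: hedge_def wn_fold_node)

lemma hedge_in_hedges:
  assumes "structured_alphabet \<Sigma>" "w \<in> well_nested \<Sigma>"
  shows "hedge \<Sigma> w \<in> hedges (calls \<Sigma> \<times> rets \<Sigma>)"
  using assms(2)
proof (induction rule: wn_induct)
  case Nil
  then show ?case by (simp add: hedge_Nil[OF assms(1)] hedges_def)
next
  case (node c r w1 w2)
  then show ?case by (auto simp: hedge_node[OF assms(1)] hedges_def)
qed

section \<open>Visibly pushdown transducers\<close>

text \<open>A transition \<open>(q, a, g, v, q')\<close> goes from \<open>q\<close> to \<open>q'\<close>, reads \<open>a\<close>, pushes or
  pops \<open>g\<close>, and outputs \<open>v\<close>.\<close>

record ('s, 'g, 'a, 'b) vpt =
  vstates :: "'s set"
  vinit :: "'s set"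
  vfinal :: "'s set"
  vstack :: "'g set"
  vbottom :: 'g
  vcalls :: "('s \<times> 'a \<times> 'g \<times> 'b list \<times> 's) set"
  vrets :: "('s \<times> 'a \<times> 'g \<times> 'b list \<times> 's) set"

definition is_vpt :: "'a salphabet \<Rightarrow> 'b set \<Rightarrow> ('s, 'g, 'a, 'b) vpt \<Rightarrow> bool" where
  "is_vpt \<Sigma> D A \<longleftrightarrow>
     finite (vstates A) \<and> vinit A \<subseteq> vstates A \<and> vfinal A \<subseteq> vstates A \<and>
     finite (vstack A) \<and> vbottom A \<notin> vstack A \<and>
     finite (vcalls A) \<and> finite (vrets A) \<and>
     vcalls A \<subseteq> vstates A \<times> calls \<Sigma> \<times> vstack A \<times> lists D \<times> vstates A \<and>
     vrets A \<subseteq> vstates A \<times> rets \<Sigma> \<times> vstack A \<times> lists D \<times> vstates A"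

text \<open>\<open>vpt_run A (q, s) u v (q', s')\<close>: some run on \<open>u\<close> with output \<open>v\<close> leads from
  \<open>(q, s)\<close> to \<open>(q', s')\<close>. The bottom of a stack is its first element, its top the last.\<close>

inductive vpt_run ::
  "('s, 'g, 'a, 'b) vpt \<Rightarrow> 's \<times> 'g list \<Rightarrow> 'a list \<Rightarrow> 'b list \<Rightarrow> 's \<times> 'g list \<Rightarrow> bool"
  for A where
  run_Nil: "vpt_run A k [] [] k"
| run_call: "(q, a, g, v, q') \<in> vcalls A \<Longrightarrow> vpt_run A (q', s @ [g]) u x k \<Longrightarrow>
             vpt_run A (q, s) (a # u) (v @ x) k"
| run_ret: "(q, a, g, v, q') \<in> vrets A \<Longrightarrow> vpt_run A (q', s) u x k \<Longrightarrow>
            vpt_run A (q, s @ [g]) (a # u) (v @ x) k"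

definition vpt_rel :: "('s, 'g, 'a, 'b) vpt \<Rightarrow> ('a list \<times> 'b list) set" where
  "vpt_rel A = {(u, v). \<exists>q\<in>vinit A. \<exists>q'\<in>vfinal A.
                  vpt_run A (q, [vbottom A]) u v (q', [vbottom A])}"

definition well_nested_vpt :: "'b salphabet \<Rightarrow> ('s, 'g, 'a, 'b) vpt \<Rightarrow> bool" where
  "well_nested_vpt \<Delta> A \<longleftrightarrow>
     (\<forall>g\<in>vstack A. \<forall>q c v q' p r v' p'.
        (q, c, g, v, q') \<in> vcalls A \<longrightarrow> (p, r, g, v', p') \<in> vrets A \<longrightarrow>
        v @ v' \<in> well_nested \<Delta>)"

section \<open>Hedge-to-string and hedge-to-hedge transducers\<close>

text \<open>\<open>Empty_rule q\<close> is \<open>q(0) \<rightarrow> \<epsilon>\<close>, and \<open>Node_rule q f w1 q1 w2 q2 w3\<close> is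
  \<open>q(f(x\<^sub>1) \<cdot> x\<^sub>2) \<rightarrow> w1 q1(x\<^sub>1) w2 q2(x\<^sub>2) w3\<close>.\<close>

datatype ('s, 'f, 'b) hrule =
    Empty_rule 's
  | Node_rule 's 'f "'b list" 's "'b list" 's "'b list"

record ('s, 'f, 'b) hst =
  hstates :: "'s set"
  hinit :: "'s set"
  hrules :: "('s, 'f, 'b) hrule set"

definition is_hst :: "'f set \<Rightarrow> 'b set \<Rightarrow> ('s, 'f, 'b) hst \<Rightarrow> bool" where
  "is_hst \<Lambda> D T \<longleftrightarrow>
     finite (hstates T) \<and> hinit T \<subseteq> hstates T \<and> finite (hrules T) \<and>
     (\<forall>q. Empty_rule q \<in> hrules T \<longrightarrow> q \<in> hstates T) \<and>
     (\<forall>q f w1 q1 w2 q2 w3. Node_rule q f w1 q1 w2 q2 w3 \<in> hrules T \<longrightarrow>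
        q \<in> hstates T \<and> q1 \<in> hstates T \<and> q2 \<in> hstates T \<and> f \<in> \<Lambda> \<and>
        w1 \<in> lists D \<and> w2 \<in> lists D \<and> w3 \<in> lists D)"

fun hst_sem :: "('s, 'f, 'b) hst \<Rightarrow> 's \<Rightarrow> 'f hedge \<Rightarrow> 'b list set" where
  "hst_sem T q [] = (if Empty_rule q \<in> hrules T then {[]} else {})"
| "hst_sem T q (Tree f h # h') =
     {w1 @ s1 @ w2 @ s2 @ w3 | w1 q1 w2 q2 w3 s1 s2.
        Node_rule q f w1 q1 w2 q2 w3 \<in> hrules T \<and>
        s1 \<in> hst_sem T q1 h \<and> s2 \<in> hst_sem T q2 h'}"

definition hst_rel :: "('s, 'f, 'b) hst \<Rightarrow> ('f hedge \<times> 'b list) set" where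
  "hst_rel T = {(h, s). \<exists>q\<in>hinit T. s \<in> hst_sem T q h}"

lemma hst_sem_subset:
  assumes "is_hst \<Lambda> D T" "s \<in> hst_sem T q h"
  shows "h \<in> hedges \<Lambda> \<and> s \<in> lists D"
  using assms
proof (induction T q h arbitrary: s rule: hst_sem.induct[case_names Nil Cons])
  case (Nil T q)
  then show ?case by (auto simp: hedges_def split: if_splits)
next
  case (Cons T q f h h')
  then obtain w1 q1 w2 q2 w3 s1 s2 where *: "Node_rule q f w1 q1 w2 q2 w3 \<in> hrules T"
    "s1 \<in> hst_sem T q1 h" "s2 \<in> hst_sem T q2 h'" "s = w1 @ s1 @ w2 @ s2 @ w3"
    by auto
  have "f \<in> \<Lambda>" "w1 \<in> lists D" "w2 \<in> lists D" "w3 \<in> lists D"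
    using Cons.prems(1) *(1) unfolding is_hst_def by blast+
  moreover have "h \<in> hedges \<Lambda> \<and> s1 \<in> lists D" "h' \<in> hedges \<Lambda> \<and> s2 \<in> lists D"
    using Cons.IH Cons.prems(1) * by blast+
  ultimately show ?case using *(4) by (auto simp: hedges_def)
qed

definition hedge_to_hedge :: "'b salphabet \<Rightarrow> ('s, 'f, 'b) hst \<Rightarrow> bool" where
  "hedge_to_hedge \<Delta> T \<longleftrightarrow>
     (\<forall>q f w1 q1 w2 q2 w3. Node_rule q f w1 q1 w2 q2 w3 \<in> hrules T \<longrightarrow>
        w1 @ w2 @ w3 \<in> well_nested \<Delta>)"

section \<open>Acceptance and precomposition\<close>

definition accepts :: "('x \<times> 'y) set \<Rightarrow> 'x \<Rightarrow> bool" where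
  "accepts R x \<longleftrightarrow> (\<exists>y. (x, y) \<in> R)"

definition precomp :: "('x \<times> 'y) set \<Rightarrow> ('w \<Rightarrow> 'x) \<Rightarrow> 'w set \<Rightarrow> ('w \<times> 'y) set" where
  "precomp R f W = {(w, s). w \<in> W \<and> (f w, s) \<in> R}"

end

theory Submission
  imports Defs
begin

text \<open>The subhedges of a node are encoded side by side between its call and its return, so a run of
  \<open>A\<close> on an encoding is described by its end states, and a hedge transducer whose states are such
  pairs can guess it. The output of a leaf of the encoding is inserted into the output pair of its
  parent, which stays well-nested.

  Conversely, a rule of \<open>T\<close> may output \<open>w2\<close> between the two subhedges, where the encoding has no
  letter. The matching in \<open>w1 @ w2 @ w3\<close> splits it into \<open>a @ b\<close>, \<open>c @ d\<close>, \<open>e @ f\<close> with \<open>a @ f\<close>, \<open>b @ c\<close>,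
  \<open>d @ e\<close> well-nested; the node outputs \<open>a\<close> and \<open>f\<close>, and the pairs \<open>(b, c)\<close> and \<open>(d, e)\<close> are delegated
  to the first and to the second subhedge, whose encodings are never empty.\<close>

section \<open>Well-nested words\<close>

text \<open>Induction on the construction of \<open>w\<close>: in a concatenation the cut falls into
  one factor; in a wrapped word it lies at an end, which again gives a concatenation, or strictly
  inside, where the induction hypothesis applies.\<close>

lemma wn_insert:
  assumes "w \<in> well_nested \<Sigma>" "w = v @ v'" "u \<in> well_nested \<Sigma>"
  shows "v @ u @ v' \<in> well_nested \<Sigma>"
  using assms(1,2)
proof (induction arbitrary: v v')
  case wn_Nil
  then show ?case using assms(3) by simp
next
  case (wn_append x y)
  from wn_append.prems consider us where "x = v @ us" "v' = us @ y"
    | us where "v = x @ us" "y = us @ v'"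
    by (auto simp: append_eq_append_conv2)
  then show ?case
  proof cases
    case 1
    then show ?thesis using well_nested.wn_append[OF wn_append.IH(1) wn_append.hyps(2)] by simp
  next
    case 2
    then show ?thesis using well_nested.wn_append[OF wn_append.hyps(1) wn_append.IH(2)] by simp
  qed
next
  case (wn_wrap w c r)
  note whole = well_nested.wn_wrap[OF wn_wrap.hyps]
  show ?case
  proof (cases v)
    case Nil
    then show ?thesis using wn_append[OF assms(3) whole] wn_wrap.prems by simp
  next
    case (Cons c' v1)
    show ?thesis
    proof (cases v' rule: rev_cases)
      case Nil
      then show ?thesis using wn_append[OF whole assms(3)] wn_wrap.prems by simp
    next
      case (snoc v1' r')
      then have "w = v1 @ v1'" "c' = c" "r' = r" using wn_wrap.prems Cons by auto
      then show ?thesis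
        using well_nested.wn_wrap[OF wn_wrap.IH wn_wrap.hyps(2,3)] Cons snoc by simp
    qed
  qed
qed

section \<open>Splitting a well-nested word at two cuts\<close>

inductive wn_split :: "'a salphabet \<Rightarrow> 'a list \<Rightarrow> 'a list \<Rightarrow> 'a list \<Rightarrow> bool" for \<Sigma> where
  wn_splitI: "a @ f \<in> well_nested \<Sigma> \<Longrightarrow> b @ c \<in> well_nested \<Sigma> \<Longrightarrow> d @ e \<in> well_nested \<Sigma> \<Longrightarrow>
    wn_split \<Sigma> (a @ b) (c @ d) (e @ f)"

text \<open>If both cuts fall into the same factor of a concatenation, the other factor joins the
  outer pair \<open>(a, f)\<close>; if they fall into different factors, these factors are the two
  inner pairs. In a wrapped word the enclosing letters join the outer pair when \<open>w1\<close>
  and \<open>w3\<close> are both nonempty.\<close>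

lemma wn_split_total:
  assumes "w \<in> well_nested \<Sigma>" "w = w1 @ w2 @ w3"
  shows "wn_split \<Sigma> w1 w2 w3"
  using assms
proof (induction arbitrary: w1 w2 w3)
  case wn_Nil
  then show ?case
    using wn_splitI[of "[]" "[]" \<Sigma> "[]" "[]" "[]" "[]"]
    by (simp add: well_nested.wn_Nil)
next
  case (wn_append x y)
  from wn_append.prems consider us where "w1 = x @ us" "y = us @ w2 @ w3"
    | us vs where "w2 = us @ vs" "x = w1 @ us" "y = vs @ w3"
    | us where "w3 = us @ y" "x = w1 @ w2 @ us"
    by (auto simp: append_eq_append_conv2)
  then show ?case
  proof cases
    case 1
    from wn_append.IH(2)[OF 1(2)] show ?thesis
    proof cases
      case (wn_splitI a f b c d e)
      moreover have "(x @ a) @ f \<in> well_nested \<Sigma>"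
        using well_nested.wn_append[OF wn_append.hyps(1) wn_splitI(4)] by simp
      ultimately show ?thesis using wn_split.wn_splitI[of "x @ a" f] 1(1) by simp
    qed
  next
    case 2
    then show ?thesis using wn_splitI[of "[]" "[]" \<Sigma> w1 us vs w3] wn_append.hyps
      by (simp add: wn_Nil)
  next
    case 3
    from wn_append.IH(1)[OF 3(2)] show ?thesis
    proof cases
      case (wn_splitI a f b c d e)
      moreover have "a @ f @ y \<in> well_nested \<Sigma>"
        using well_nested.wn_append[OF wn_splitI(4) wn_append.hyps(2)] by simp
      ultimately show ?thesis using wn_split.wn_splitI[of a "f @ y"] 3(1) by simp
    qed
  qed
next
  case (wn_wrap w c r)
  note whole = well_nested.wn_wrap[OF wn_wrap.hyps]
  show ?case
  proof (cases w1)
    case Nil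
    \<comment> \<open>With \<open>w1\<close> empty the whole word becomes the pair
      \<open>(d, e)\<close>; below, with \<open>w3\<close> empty, it becomes
      \<open>(b, c)\<close>.\<close>
    then show ?thesis
      using wn_splitI[of "[]" "[]" \<Sigma> "[]" "[]" w2 w3] whole wn_wrap.prems by (simp add: wn_Nil)
  next
    case (Cons c' v1)
    show ?thesis
    proof (cases w3 rule: rev_cases)
      case Nil
      then show ?thesis
        using wn_splitI[of "[]" "[]" \<Sigma> w1 w2 "[]" "[]"] whole wn_wrap.prems by (simp add: wn_Nil)
    next
      case (snoc v3 r')
      then have eq: "w = v1 @ w2 @ v3" "c' = c" "r' = r" using wn_wrap.prems Cons by auto
      from wn_wrap.IH[OF eq(1)] show ?thesis
      proof cases
        case (wn_splitI a f b c1 d e)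
        moreover have "(c # a) @ f @ [r] \<in> well_nested \<Sigma>"
          using well_nested.wn_wrap[OF wn_splitI(4) wn_wrap.hyps(2,3)] by simp
        ultimately show ?thesis
          using wn_split.wn_splitI[of "c # a" "f @ [r]"] Cons snoc eq(2,3) by simp
      qed
    qed
  qed
qed

section \<open>Runs on well-nested words\<close>

lemma vpt_run_trans:
  "vpt_run A k u x k' \<Longrightarrow> vpt_run A k' v y k'' \<Longrightarrow> vpt_run A k (u @ v) (x @ y) k''"
  by (induction rule: vpt_run.induct) (auto intro: vpt_run.intros)

lemma vpt_run_appendE:
  assumes "vpt_run A k (u @ v) x k''"
  obtains y z k' where "x = y @ z" "vpt_run A k u y k'" "vpt_run A k' v z k''"
proof -
  have "\<exists>y z k'. x = y @ z \<and> vpt_run A k u y k' \<and> vpt_run A k' v z k''"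
    using assms
  proof (induction k "u @ v" x k'' arbitrary: u rule: vpt_run.induct)
    case (run_Nil k)
    then show ?case by (intro exI[of _ "[]"] exI[of _ k]) (simp add: vpt_run.run_Nil)
  next
    case (run_call q a g x q' s w y k)
    show ?case
    proof (cases u)
      case Nil
      then show ?thesis
        using run_call.hyps(4) vpt_run.run_call[OF run_call.hyps(1,2)]
        by (intro exI[of _ "[]"] exI[of _ "x @ y"] exI[of _ "(q, s)"]) (simp add: vpt_run.run_Nil)
    next
      case (Cons b u')
      then obtain y1 z k' where "y = y1 @ z" "vpt_run A (q', s @ [g]) u' y1 k'" "vpt_run A k' v z k"
        using run_call.hyps by auto
      then show ?thesis
        using Cons run_call.hyps(4) vpt_run.run_call[OF run_call.hyps(1), of s u' y1 k']
        by (intro exI[of _ "x @ y1"] exI[of _ z] exI[of _ k']) simp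
    qed
  next
    case (run_ret q a g x q' s w y k)
    show ?case
    proof (cases u)
      case Nil
      then show ?thesis
        using run_ret.hyps(4) vpt_run.run_ret[OF run_ret.hyps(1,2)]
        by (intro exI[of _ "[]"] exI[of _ "x @ y"] exI[of _ "(q, s @ [g])"]) (simp add: vpt_run.run_Nil)
    next
      case (Cons b u')
      then obtain y1 z k' where "y = y1 @ z" "vpt_run A (q', s) u' y1 k'" "vpt_run A k' v z k"
        using run_ret.hyps by auto
      then show ?thesis
        using Cons run_ret.hyps(4) vpt_run.run_ret[OF run_ret.hyps(1), of s u' y1 k']
        by (intro exI[of _ "x @ y1"] exI[of _ z] exI[of _ k']) simp
    qed
  qed
  then show thesis using that by blast
qed

text \<open>A transition touches only the top of the stack, so symbols placed at the bottom are
  carried along unchanged.\<close>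

lemma vpt_run_frame:
  assumes "vpt_run A (p, s) u x (q, s')"
  shows "vpt_run A (p, t @ s) u x (q, t @ s')"
proof -
  have "vpt_run A (fst k, t @ snd k) u x (fst k', t @ snd k')" if "vpt_run A k u x k'" for k k'
    using that
  proof induction
    case (run_Nil k)
    then show ?case by (rule vpt_run.run_Nil)
  next
    case (run_call p a g v q' s u x k)
    then show ?case by (simp add: vpt_run.run_call)
  next
    case (run_ret p a g v q' s u x k)
    then show ?case using vpt_run.run_ret[where s = "t @ s"] by simp
  qed
  from this[OF assms] show ?thesis by simp
qed

lemma vpt_run_states:
  assumes "is_vpt \<Sigma> D A" "vpt_run A k u x k'" "fst k \<in> vstates A"
  shows "fst k' \<in> vstates A"
  using assms(2,3,1)
  by (induction rule: vpt_run.induct) (auto simp: is_vpt_def)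

text \<open>The letter decides the kind of the first transition, because the transitions are typed
  and the two alphabets are disjoint.\<close>

lemma vpt_run_callE:
  assumes "is_vpt \<Sigma> D A" "calls \<Sigma> \<inter> rets \<Sigma> = {}" "c \<in> calls \<Sigma>" "vpt_run A (p, s) (c # u) x k"
  obtains g v p' y where "(p, c, g, v, p') \<in> vcalls A" "vpt_run A (p', s @ [g]) u y k" "x = v @ y"
  using assms(4)
proof (cases rule: vpt_run.cases)
  case (run_ret g v q' s' y)
  then have "c \<in> rets \<Sigma>" using assms(1) unfolding is_vpt_def by blast
  then show thesis using assms(2,3) by blast
qed (use that in blast)

lemma vpt_run_retE:
  assumes "is_vpt \<Sigma> D A" "calls \<Sigma> \<inter> rets \<Sigma> = {}" "r \<in> rets \<Sigma>" "vpt_run A (p, s) [r] x (q, s')"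
  obtains g where "(p, r, g, x, q) \<in> vrets A" "s = s' @ [g]"
  using assms(4)
proof (cases rule: vpt_run.cases)
  case (run_call g v q' y)
  then have "r \<in> calls \<Sigma>" using assms(1) unfolding is_vpt_def by blast
  then show thesis using assms(2,3) by blast
next
  case (run_ret g v q' s1 y)
  from run_ret(4) have "y = []" "(q', s1) = (q, s')" by (auto elim: vpt_run.cases)
  then show thesis using run_ret that by simp
qed

text \<open>Every symbol pushed while reading \<open>u\<close> is popped by the matching return, and
  nothing of \<open>s\<close> is ever popped; hence \<open>s\<close> comes back intact and may as
  well be removed.\<close>

lemma vpt_run_wn:
  assumes "is_vpt \<Sigma> D A" "calls \<Sigma> \<inter> rets \<Sigma> = {}" "u \<in> well_nested \<Sigma>"
    and "vpt_run A (p, s) u x (q, s')"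
  shows "s' = s \<and> vpt_run A (p, []) u x (q, [])"
  using assms(3,4)
proof (induction arbitrary: p s x q s')
  case wn_Nil
  then show ?case by (auto elim: vpt_run.cases intro: run_Nil)
next
  case (wn_append u v)
  from wn_append.prems obtain y z m t where *: "x = y @ z" "vpt_run A (p, s) u y (m, t)"
    "vpt_run A (m, t) v z (q, s')"
    by (elim vpt_run_appendE) auto
  then show ?case
    using wn_append.IH(1)[OF *(2)] wn_append.IH(2)[OF *(3)] by (auto intro: vpt_run_trans)
next
  case (wn_wrap w c r)
  from wn_wrap.prems obtain g v p1 y where 1: "(p, c, g, v, p1) \<in> vcalls A"
    "vpt_run A (p1, s @ [g]) (w @ [r]) y (q, s')" "x = v @ y"
    using vpt_run_callE[OF assms(1,2) wn_wrap.hyps(2)] by metis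
  from 1(2) obtain y1 z p2 t where 2: "y = y1 @ z" "vpt_run A (p1, s @ [g]) w y1 (p2, t)"
    "vpt_run A (p2, t) [r] z (q, s')"
    by (elim vpt_run_appendE) auto
  have 3: "t = s @ [g]" "vpt_run A (p1, []) w y1 (p2, [])" using wn_wrap.IH[OF 2(2)] by auto
  \<comment> \<open>The top of \<open>t\<close> is the \<open>g\<close> pushed by the call, so the
    popped \<open>g'\<close> equals \<open>g\<close> and \<open>s'\<close> equals
    \<open>s\<close>.\<close>
  obtain g' where 4: "(p2, r, g', z, q) \<in> vrets A" "t = s' @ [g']"
    using vpt_run_retE[OF assms(1,2) wn_wrap.hyps(3) 2(3)] by metis
  have "vpt_run A (p2, [] @ [g]) [r] (z @ []) (q, [])"
    by (rule run_ret[OF _ run_Nil]) (use 3 4 in auto)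
  then have "vpt_run A (p1, [] @ [g]) (w @ [r]) y (q, [])"
    using vpt_run_trans[OF vpt_run_frame[OF 3(2), of "[g]"], of "[r]" z] 2(1) by simp
  then show ?case using run_call[OF 1(1), of "[]"] 1(3) 3(1) 4(2) by simp
qed

text \<open>The empty list, without even a bottom symbol, is the normal form of the stack for runs
  on well-nested words; \<open>vpt_run_wn_iff\<close> transfers such runs to any other
  stack.\<close>

abbreviation balanced_run ::
  "('s, 'g, 'a, 'b) vpt \<Rightarrow> 's \<Rightarrow> 'a list \<Rightarrow> 'b list \<Rightarrow> 's \<Rightarrow> bool" where
  "balanced_run A p u x q \<equiv> vpt_run A (p, []) u x (q, [])"

lemma vpt_run_wn_iff:
  assumes "is_vpt \<Sigma> D A" "calls \<Sigma> \<inter> rets \<Sigma> = {}" "u \<in> well_nested \<Sigma>"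
  shows "vpt_run A (p, s) u x (q, s) \<longleftrightarrow> balanced_run A p u x q"
  using vpt_run_wn[OF assms] vpt_run_frame[of A p "[]" u x q "[]" s] by auto

lemma balanced_run_append:
  assumes "is_vpt \<Sigma> D A" "calls \<Sigma> \<inter> rets \<Sigma> = {}" "u \<in> well_nested \<Sigma>" "v \<in> well_nested \<Sigma>"
  shows "balanced_run A p (u @ v) x q \<longleftrightarrow>
    (\<exists>y m z. x = y @ z \<and> balanced_run A p u y m \<and> balanced_run A m v z q)"
proof
  assume "balanced_run A p (u @ v) x q"
  then obtain y z m t where "x = y @ z" "vpt_run A (p, []) u y (m, t)" "vpt_run A (m, t) v z (q, [])"
    by (elim vpt_run_appendE) auto
  then show "\<exists>y m z. x = y @ z \<and> balanced_run A p u y m \<and> balanced_run A m v z q"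
    using vpt_run_wn[OF assms(1,2)] assms(3,4) by metis
qed (auto intro: vpt_run_trans)

lemma balanced_run_wrap:
  assumes "is_vpt \<Sigma> D A" "calls \<Sigma> \<inter> rets \<Sigma> = {}" "u \<in> well_nested \<Sigma>" "c \<in> calls \<Sigma>" "r \<in> rets \<Sigma>"
  shows "balanced_run A p (c # u @ [r]) x q \<longleftrightarrow>
    (\<exists>g v p1 y p2 v'. (p, c, g, v, p1) \<in> vcalls A \<and> balanced_run A p1 u y p2 \<and>
       (p2, r, g, v', q) \<in> vrets A \<and> x = v @ y @ v')" (is "_ = ?rhs")
proof
  assume "balanced_run A p (c # u @ [r]) x q"
  then obtain g v p1 y where 1: "(p, c, g, v, p1) \<in> vcalls A"
    "vpt_run A (p1, [g]) (u @ [r]) y (q, [])" "x = v @ y"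
    using vpt_run_callE[OF assms(1,2,4)] by (metis append_Nil)
  from 1(2) obtain y1 z p2 t where 2: "y = y1 @ z" "vpt_run A (p1, [g]) u y1 (p2, t)"
    "vpt_run A (p2, t) [r] z (q, [])"
    by (elim vpt_run_appendE) auto
  have 3: "t = [g]" "balanced_run A p1 u y1 p2" using vpt_run_wn[OF assms(1-3) 2(2)] by auto
  have "(p2, r, g, z, q) \<in> vrets A"
    using vpt_run_retE[OF assms(1,2,5) 2(3)] 3(1) by auto
  then show ?rhs using 1 2 3 by blast
next
  assume ?rhs
  then obtain g v p1 y p2 v' where *: "(p, c, g, v, p1) \<in> vcalls A" "balanced_run A p1 u y p2"
    "(p2, r, g, v', q) \<in> vrets A" "x = v @ y @ v'"
    by blast
  have "vpt_run A (p2, [] @ [g]) [r] (v' @ []) (q, [])"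
    by (rule run_ret[OF *(3) run_Nil])
  then have "vpt_run A (p1, [] @ [g]) (u @ [r]) (y @ v') (q, [])"
    using vpt_run_trans[OF vpt_run_frame[OF *(2), of "[g]"], of "[r]" v'] by simp
  then show "balanced_run A p (c # u @ [r]) x q" using run_call[OF *(1)] *(4) by simp
qed

section \<open>Runs on first-child next-sibling encodings\<close>

lemma bot_ext_disjoint:
  assumes "structured_alphabet \<Sigma>" "bc \<notin> syms \<Sigma>" "br \<notin> syms \<Sigma>" "bc \<noteq> br"
  shows "calls (bot_ext \<Sigma> bc br) \<inter> rets (bot_ext \<Sigma> bc br) = {}"
  using assms by (auto simp: structured_alphabet_def bot_ext_def)

locale fcns_alphabet =
  fixes \<Sigma> :: "'a salphabet" and bc br :: 'a
  assumes sigma: "structured_alphabet \<Sigma>"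
    and fresh: "bc \<notin> syms \<Sigma>" "br \<notin> syms \<Sigma>" "bc \<noteq> br"
begin

abbreviation \<Sigma>' where "\<Sigma>' \<equiv> bot_ext \<Sigma> bc br"
abbreviation enc where "enc \<equiv> fcns \<Sigma> bc br"

lemmas disj = bot_ext_disjoint[OF sigma fresh]

lemma balanced_run_enc_Nil:
  assumes "is_vpt \<Sigma>' D A"
  shows "balanced_run A p (enc []) x q \<longleftrightarrow>
    (\<exists>g v p1 v'. (p, bc, g, v, p1) \<in> vcalls A \<and> (p1, br, g, v', q) \<in> vrets A \<and> x = v @ v')"
proof -
  have "balanced_run A p [] x q \<longleftrightarrow> x = [] \<and> p = q" for p x q
    by (auto elim: vpt_run.cases intro: run_Nil)
  then show ?thesis
    using balanced_run_wrap[OF assms disj wn_Nil, of bc br p x q]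
    by (simp add: fcns_Nil[OF sigma] bot_ext_def)
qed

text \<open>Together with \<open>balanced_run_enc_Nil\<close> this turns runs on encodings into a
  recursion parallel to that of \<open>hst_sem\<close> on hedges; \<open>m\<close> is the state
  reached between the two subhedges.\<close>

lemma balanced_run_enc_node:
  assumes "is_vpt \<Sigma>' D A" "c \<in> calls \<Sigma>" "r \<in> rets \<Sigma>"
    "w1 \<in> well_nested \<Sigma>" "w2 \<in> well_nested \<Sigma>"
  shows "balanced_run A p (enc (c # w1 @ r # w2)) x q \<longleftrightarrow>
    (\<exists>g v p1 y1 m y2 p2 v'. (p, c, g, v, p1) \<in> vcalls A \<and> balanced_run A p1 (enc w1) y1 m \<and>
       balanced_run A m (enc w2) y2 p2 \<and> (p2, r, g, v', q) \<in> vrets A \<and>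
       x = v @ (y1 @ y2) @ v')" (is "_ \<longleftrightarrow> ?rhs")
proof -
  note wn = fcns_well_nested[OF sigma assms(4)] fcns_well_nested[OF sigma assms(5)]
  have "c \<in> calls \<Sigma>'" "r \<in> rets \<Sigma>'" using assms(2,3) by (auto simp: bot_ext_def)
  note iff = balanced_run_wrap[OF assms(1) disj wn_append[OF wn] this, of p x q]
  have "balanced_run A p (enc (c # w1 @ r # w2)) x q \<longleftrightarrow>
      balanced_run A p (c # (enc w1 @ enc w2) @ [r]) x q"
    by (simp add: fcns_node[OF sigma assms(2-5)])
  also have "\<dots> \<longleftrightarrow> ?rhs"
    unfolding iff balanced_run_append[OF assms(1) disj wn] by blast
  finally show ?thesis .
qed

lemma vpt_rel_enc:
  assumes "is_vpt \<Sigma>' D A" "w \<in> well_nested \<Sigma>"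
  shows "(enc w, s) \<in> vpt_rel A \<longleftrightarrow>
    (\<exists>q\<in>vinit A. \<exists>q'\<in>vfinal A. balanced_run A q (enc w) s q')"
  by (simp add: vpt_rel_def
      vpt_run_wn_iff[OF assms(1) disj fcns_well_nested[OF sigma assms(2)], of _ "[vbottom A]"])

end

section \<open>From transducers on encodings to hedge transducers\<close>

locale vpt_on_fcns = fcns_alphabet \<Sigma> bc br for \<Sigma> :: "'a salphabet" and bc br :: 'a +
  fixes \<Delta> :: "'b salphabet" and A :: "('s, 'g, 'a, 'b) vpt"
  assumes vpt: "is_vpt \<Sigma>' (syms \<Delta>) A"
begin

text \<open>A leaf \<open>bc br\<close> of the encoding may produce output, but the empty hedge may not, so the
  output of a leaf moves into the rule of its parent: \<open>child p m t u\<close> says that this rule emits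
  \<open>u\<close> and continues in \<open>t\<close> on the subhedge, which is empty if \<open>t = None\<close>.\<close>

inductive child :: "'s \<Rightarrow> 's \<Rightarrow> ('s \<times> 's) option \<Rightarrow> 'b list \<Rightarrow> bool" where
  inner: "child p m (Some (p, m)) []"
| leaf: "(p, bc, g, v, p') \<in> vcalls A \<Longrightarrow> (p', br, g, v', m) \<in> vrets A \<Longrightarrow> child p m None (v @ v')"

text \<open>\<open>Some (p, q)\<close> serves the nonempty hedges that \<open>A\<close> reads from
  \<open>p\<close> to \<open>q\<close>, \<open>None\<close> the empty hedge. The words
  \<open>u1\<close> and \<open>u2\<close> stand exactly where \<open>A\<close> would read the
  leaves. The guessed \<open>m\<close> is restricted to states of \<open>A\<close> because
  \<open>inner\<close> puts no constraint on it.\<close>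

inductive_set run_rules :: "(('s \<times> 's) option, 'a \<times> 'a, 'b) hrule set" where
  empty: "Empty_rule None \<in> run_rules"
| node: "(p, c, g, v, p1) \<in> vcalls A \<Longrightarrow> (p2, r, g, v', q) \<in> vrets A \<Longrightarrow>
    c \<in> calls \<Sigma> \<Longrightarrow> r \<in> rets \<Sigma> \<Longrightarrow> m \<in> vstates A \<Longrightarrow>
    child p1 m t1 u1 \<Longrightarrow> child m p2 t2 u2 \<Longrightarrow>
    Node_rule (Some (p, q)) (c, r) (v @ u1) t1 u2 t2 v' \<in> run_rules"

text \<open>All initial states have the form \<open>Some (p, q)\<close>, so the empty hedge is
  rejected.\<close>

definition run_hst :: "(('s \<times> 's) option, 'a \<times> 'a, 'b) hst" where
  "run_hst = \<lparr>hstates = insert None (Some ` (vstates A \<times> vstates A)),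
     hinit = Some ` (vinit A \<times> vfinal A), hrules = run_rules\<rparr>"

lemma child_states:
  assumes "child p m t u" "p \<in> vstates A" "m \<in> vstates A"
  shows "t \<in> hstates run_hst \<and> u \<in> lists (syms \<Delta>)"
  using assms(1)
proof cases
  case (leaf g v p' v')
  then have "v \<in> lists (syms \<Delta>)" "v' \<in> lists (syms \<Delta>)" using vpt unfolding is_vpt_def by blast+
  then show ?thesis
    using leaf by (auto simp: run_hst_def)
qed (use assms in \<open>auto simp: run_hst_def\<close>)

text \<open>A rule is determined by a call transition, a return transition and two pairs from
  \<open>?T\<close> and \<open>?U\<close>; the guessed state \<open>m\<close> enters only through
  these pairs. For \<open>?U\<close> it is enough to combine all calls with all returns, whether or
  not they match.\<close>

lemma finite_run_rules: "finite run_rules"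
proof -
  let ?out = "\<lambda>((_, _, _, v, _), (_, _, _, v', _)). v @ v'"
  let ?T = "insert None (Some ` (vstates A \<times> vstates A))"
  let ?U = "insert [] (?out ` (vcalls A \<times> vrets A))"
  let ?rule = "\<lambda>((p, c, _, v, _), (_, r, _, v', q), (t1, u1), (t2, u2)).
    Node_rule (Some (p, q)) (c, r) (v @ u1) t1 u2 t2 v'"
  have child: "(t, u) \<in> ?T \<times> ?U" if "child p m t u" "p \<in> vstates A" "m \<in> vstates A" for p m t u
    using that(1)
  proof cases
    case inner
    then show ?thesis using that(2,3) by simp
  next
    case (leaf g v p' v')
    have "?out ((p, bc, g, v, p'), (p', br, g, v', m)) \<in> ?out ` (vcalls A \<times> vrets A)"
      using leaf(3,4) by (intro imageI SigmaI)
    then show ?thesis unfolding leaf by simp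
  qed
  have "run_rules \<subseteq> insert (Empty_rule None)
      (?rule ` (vcalls A \<times> vrets A \<times> (?T \<times> ?U) \<times> (?T \<times> ?U)))"
  proof
    fix x assume "x \<in> run_rules"
    then show "x \<in> insert (Empty_rule None)
      (?rule ` (vcalls A \<times> vrets A \<times> (?T \<times> ?U) \<times> (?T \<times> ?U)))"
    proof cases
      case (node p c g v p1 p2 r v' q m t1 u1 t2 u2)
      have "p1 \<in> vstates A" "p2 \<in> vstates A"
        using node(2,3) vpt unfolding is_vpt_def by blast+
      then have "(t1, u1) \<in> ?T \<times> ?U" "(t2, u2) \<in> ?T \<times> ?U"
        using child node(6-8) by blast+
      then have "((p, c, g, v, p1), (p2, r, g, v', q), (t1, u1), (t2, u2))
          \<in> vcalls A \<times> vrets A \<times> (?T \<times> ?U) \<times> (?T \<times> ?U)"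
        using node(2,3) by blast
      then have "?rule ((p, c, g, v, p1), (p2, r, g, v', q), (t1, u1), (t2, u2))
          \<in> ?rule ` (vcalls A \<times> vrets A \<times> (?T \<times> ?U) \<times> (?T \<times> ?U))"
        by (rule imageI)
      then show ?thesis unfolding node(1) by simp
    qed simp
  qed
  moreover have "finite (vstates A)" "finite (vcalls A)" "finite (vrets A)"
    using vpt by (simp_all add: is_vpt_def)
  ultimately show ?thesis
    by (elim finite_subset) (intro finite_insert[THEN iffD2] finite_imageI finite_cartesian_product)
qed

lemma run_hst_is_hst: "is_hst (calls \<Sigma> \<times> rets \<Sigma>) (syms \<Delta>) run_hst"
proof -
  have "q \<in> hstates run_hst \<and> q1 \<in> hstates run_hst \<and> q2 \<in> hstates run_hst \<and>
      f \<in> calls \<Sigma> \<times> rets \<Sigma> \<and> w1 \<in> lists (syms \<Delta>) \<and> w2 \<in> lists (syms \<Delta>) \<and> w3 \<in> lists (syms \<Delta>)"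
    if "Node_rule q f w1 q1 w2 q2 w3 \<in> run_rules" for q f w1 q1 w2 q2 w3
    using that
  proof cases
    case (node p c g v p1 p2 r q m u1)
    have "p \<in> vstates A" "p1 \<in> vstates A" "p2 \<in> vstates A" "q \<in> vstates A"
      "v \<in> lists (syms \<Delta>)" "w3 \<in> lists (syms \<Delta>)"
      using node(4,5) vpt unfolding is_vpt_def by blast+
    then show ?thesis
      using node child_states[of p1 m] child_states[of m p2] by (auto simp: run_hst_def)
  qed
  moreover have "q \<in> hstates run_hst" if "Empty_rule q \<in> run_rules" for q
    using that by cases (simp add: run_hst_def)
  moreover have "finite (hstates run_hst)" "hinit run_hst \<subseteq> hstates run_hst"
    using vpt by (auto simp: run_hst_def is_vpt_def)
  ultimately show ?thesis
    using finite_run_rules unfolding is_hst_def by (simp add: run_hst_def)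
qed

lemma child_wn:
  assumes "well_nested_vpt \<Delta> A" "child p m t u"
  shows "u \<in> well_nested \<Delta>"
  using assms(2)
proof cases
  case (leaf g v p' v')
  then have "g \<in> vstack A" using vpt unfolding is_vpt_def by blast
  then show ?thesis using leaf assms(1) unfolding well_nested_vpt_def by blast
qed (simp add: wn_Nil)

text \<open>The outputs of a matching call and return form a well-nested pair, and
  \<open>wn_insert\<close> allows the well-nested outputs of the leaves between them.\<close>

lemma run_hst_hedge_to_hedge:
  assumes "well_nested_vpt \<Delta> A"
  shows "hedge_to_hedge \<Delta> run_hst"
proof -
  have "w1 @ w2 @ w3 \<in> well_nested \<Delta>"
    if "Node_rule q f w1 q1 w2 q2 w3 \<in> run_rules" for q f w1 q1 w2 q2 w3
    using that
  proof cases
    case (node p c g v p1 p2 r q m u1)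
    have "g \<in> vstack A" using node(4) vpt unfolding is_vpt_def by blast
    then have "v @ w3 \<in> well_nested \<Delta>"
      using node(4,5) assms unfolding well_nested_vpt_def by blast
    moreover have "u1 @ w2 \<in> well_nested \<Delta>"
      using node child_wn[OF assms] by (blast intro: wn_append)
    ultimately show ?thesis
      using wn_insert[of "v @ w3" \<Delta> v w3 "u1 @ w2"] node(3) by simp
  qed
  then show ?thesis unfolding hedge_to_hedge_def by (simp add: run_hst_def)
qed

text \<open>With the next lemma: the hedge alone decides whether \<open>None\<close> or some
  \<open>Some (p, q)\<close> can have an output on it, and therefore which clause of
  \<open>child\<close> applies.\<close>

lemma run_hst_sem_None_node: "hst_sem run_hst None (Tree f h # h') = {}"
  by (auto simp: run_hst_def elim: run_rules.cases)

lemma run_hst_sem_Some_Nil: "hst_sem run_hst (Some pq) [] = {}"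
  by (auto simp: run_hst_def elim: run_rules.cases)

lemma run_hst_sem_None_Nil: "hst_sem run_hst None [] = {[]}"
  by (simp add: run_hst_def run_rules.empty)

lemma run_hst_sem_Some_node:
  "x \<in> hst_sem run_hst (Some (p, q)) (Tree (c, r) h1 # h2) \<longleftrightarrow>
    (\<exists>g v p1 p2 v' m t1 u1 t2 u2 y1 y2. (p, c, g, v, p1) \<in> vcalls A \<and> (p2, r, g, v', q) \<in> vrets A \<and>
       c \<in> calls \<Sigma> \<and> r \<in> rets \<Sigma> \<and> m \<in> vstates A \<and> child p1 m t1 u1 \<and> child m p2 t2 u2 \<and>
       y1 \<in> hst_sem run_hst t1 h1 \<and> y2 \<in> hst_sem run_hst t2 h2 \<and>
       x = (v @ u1) @ y1 @ u2 @ y2 @ v')" (is "?lhs \<longleftrightarrow> ?rhs")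
proof
  assume ?lhs
  then obtain w1 t1 u2 t2 v' y1 y2 where
    *: "Node_rule (Some (p, q)) (c, r) w1 t1 u2 t2 v' \<in> run_rules"
    "y1 \<in> hst_sem run_hst t1 h1" "y2 \<in> hst_sem run_hst t2 h2" "x = w1 @ y1 @ u2 @ y2 @ v'"
    by (auto simp: run_hst_def)
  from *(1) show ?rhs
  proof cases
    case (node g v p1 p2 m u1)
    with *(2-4) show ?thesis by blast
  qed
next
  assume ?rhs
  then obtain g v p1 p2 v' m t1 u1 t2 u2 y1 y2 where
    *: "(p, c, g, v, p1) \<in> vcalls A" "(p2, r, g, v', q) \<in> vrets A"
      "c \<in> calls \<Sigma>" "r \<in> rets \<Sigma>" "m \<in> vstates A" "child p1 m t1 u1" "child m p2 t2 u2"
    and y: "y1 \<in> hst_sem run_hst t1 h1" "y2 \<in> hst_sem run_hst t2 h2"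
      "x = (v @ u1) @ y1 @ u2 @ y2 @ v'"
    by blast
  have "Node_rule (Some (p, q)) (c, r) (v @ u1) t1 u2 t2 v' \<in> hrules run_hst"
    using run_rules.node[OF *] by (simp add: run_hst_def)
  then show ?lhs unfolding hst_sem.simps using y by blast
qed

text \<open>The invariant of the construction. It is phrased through \<open>child\<close> so that
  the induction also covers the empty word, whose output \<open>u\<close> is emitted by the rule of
  the parent.\<close>

lemma balanced_run_iff_run_hst:
  assumes "w \<in> well_nested \<Sigma>" "p \<in> vstates A" "q \<in> vstates A"
  shows "balanced_run A p (enc w) x q \<longleftrightarrow>
    (\<exists>t u y. child p q t u \<and> y \<in> hst_sem run_hst t (hedge \<Sigma> w) \<and> x = u @ y)"
  using assms
proof (induction arbitrary: p q x rule: wn_induct)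
  case Nil
  have "balanced_run A p (enc []) x q \<longleftrightarrow> child p q None x"
    unfolding balanced_run_enc_Nil[OF vpt] child.simps[of p q None x] by blast
  also have "\<dots> \<longleftrightarrow> (\<exists>t u y. child p q t u \<and> y \<in> hst_sem run_hst t [] \<and> x = u @ y)"
    (is "?l \<longleftrightarrow> ?r")
  proof
    assume ?l
    moreover have "[] \<in> hst_sem run_hst None []" "x = x @ []"
      by (simp_all add: run_hst_sem_None_Nil del: hst_sem.simps)
    ultimately show ?r by blast
  next
    assume ?r
    then obtain t u y where "child p q t u" "y \<in> hst_sem run_hst t []" "x = u @ y" by blast
    then show ?l
      by (cases t) (simp_all add: run_hst_sem_None_Nil run_hst_sem_Some_Nil del: hst_sem.simps)
  qed
  finally show ?case by (simp add: hedge_Nil[OF sigma])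
next
  case (node c r w1 w2)
  let ?h = "\<lambda>w. hedge \<Sigma> w"
  \<comment> \<open>On a nonempty hedge \<open>None\<close> has no output, so \<open>child\<close>
    can only be \<open>inner\<close>, with \<open>u\<close> empty.\<close>
  have "(\<exists>t u y. child p q t u \<and> y \<in> hst_sem run_hst t (?h (c # w1 @ r # w2)) \<and> x = u @ y) \<longleftrightarrow>
      x \<in> hst_sem run_hst (Some (p, q)) (Tree (c, r) (?h w1) # ?h w2)" (is "?l \<longleftrightarrow> ?r")
  proof
    assume ?l
    then obtain t u y where *: "child p q t u" "x = u @ y"
      "y \<in> hst_sem run_hst t (Tree (c, r) (?h w1) # ?h w2)"
      unfolding hedge_node[OF sigma node.hyps] by blast
    from *(1) show ?r
      by cases (use *(2,3) in \<open>simp_all add: run_hst_sem_None_node del: hst_sem.simps\<close>)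
  next
    assume ?r
    moreover have "x = [] @ x" by simp
    ultimately show ?l unfolding hedge_node[OF sigma node.hyps] using child.inner by blast
  qed
  moreover have "balanced_run A p (enc (c # w1 @ r # w2)) x q \<longleftrightarrow> ?r"
    (is "?run \<longleftrightarrow> _")
  proof
    assume ?run
    then obtain g v p1 y1 m y2 p2 v' where
      *: "(p, c, g, v, p1) \<in> vcalls A" "balanced_run A p1 (enc w1) y1 m"
        "balanced_run A m (enc w2) y2 p2" "(p2, r, g, v', q) \<in> vrets A" "x = v @ (y1 @ y2) @ v'"
      unfolding balanced_run_enc_node[OF vpt node.hyps] by blast
    have Q: "p1 \<in> vstates A" "p2 \<in> vstates A" using *(1,4) vpt unfolding is_vpt_def by blast+
    \<comment> \<open>Both the induction hypotheses and the rule require \<open>m\<close> to be a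
      state; it is one because runs do not leave \<open>vstates A\<close>.\<close>
    have m: "m \<in> vstates A" using vpt_run_states[OF vpt *(2)] Q by simp
    obtain t1 u1 z1 where 1: "child p1 m t1 u1" "z1 \<in> hst_sem run_hst t1 (?h w1)" "y1 = u1 @ z1"
      using node.IH(1)[OF Q(1) m] *(2) by blast
    obtain t2 u2 z2 where 2: "child m p2 t2 u2" "z2 \<in> hst_sem run_hst t2 (?h w2)" "y2 = u2 @ z2"
      using node.IH(2)[OF m Q(2)] *(3) by blast
    have "x = (v @ u1) @ z1 @ u2 @ z2 @ v'" using *(5) 1(3) 2(3) by simp
    then show ?r
      unfolding run_hst_sem_Some_node using * 1 2 m node.hyps(1,2) by blast
  next
    assume ?r
    then obtain g v p1 p2 v' m t1 u1 t2 u2 y1 y2 where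
      *: "(p, c, g, v, p1) \<in> vcalls A" "(p2, r, g, v', q) \<in> vrets A"
        "m \<in> vstates A" "child p1 m t1 u1" "child m p2 t2 u2"
        "y1 \<in> hst_sem run_hst t1 (?h w1)" "y2 \<in> hst_sem run_hst t2 (?h w2)"
        "x = (v @ u1) @ y1 @ u2 @ y2 @ v'"
      unfolding run_hst_sem_Some_node by blast
    have Q: "p1 \<in> vstates A" "p2 \<in> vstates A" using *(1,2) vpt unfolding is_vpt_def by blast+
    have "balanced_run A p1 (enc w1) (u1 @ y1) m" using node.IH(1)[OF Q(1) *(3)] * by blast
    moreover have "balanced_run A m (enc w2) (u2 @ y2) p2" using node.IH(2)[OF *(3) Q(2)] * by blast
    moreover have "x = v @ ((u1 @ y1) @ (u2 @ y2)) @ v'" using *(8) by simp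
    ultimately show ?run
      unfolding balanced_run_enc_node[OF vpt node.hyps] using *(1,2) by blast
  qed
  ultimately show ?case by simp
qed

lemma run_hst_accepts_Nil: "\<not> accepts (hst_rel run_hst) []"
  using run_hst_sem_Some_Nil by (auto simp: accepts_def hst_rel_def run_hst_def)

lemma run_hst_precomp:
  assumes "\<not> accepts (vpt_rel A) (enc [])"
  shows "precomp (vpt_rel A) enc (well_nested \<Sigma>) =
    precomp (hst_rel run_hst) (hedge \<Sigma>) (well_nested \<Sigma>)"
proof -
  have "(enc w, x) \<in> vpt_rel A \<longleftrightarrow> (hedge \<Sigma> w, x) \<in> hst_rel run_hst"
    if w: "w \<in> well_nested \<Sigma>" for w x
  proof (cases "w = []")
    case True
    \<comment> \<open>On the empty word both relations are empty, on the left by the assumption on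
      \<open>A\<close>. A nonempty word needs no parent rule, since its output is that of
      \<open>Some (p, q)\<close>.\<close>
    then show ?thesis
      using assms run_hst_accepts_Nil by (auto simp: accepts_def hedge_Nil[OF sigma])
  next
    case False
    then obtain f h h' where h: "hedge \<Sigma> w = Tree f h # h'"
      using w wn_decompose hedge_node[OF sigma] by metis
    have "balanced_run A p (enc w) x q \<longleftrightarrow> x \<in> hst_sem run_hst (Some (p, q)) (hedge \<Sigma> w)"
      if "p \<in> vinit A" "q \<in> vfinal A" for p q
    proof -
      have pq: "p \<in> vstates A" "q \<in> vstates A" using that vpt unfolding is_vpt_def by blast+
      show ?thesis
        unfolding balanced_run_iff_run_hst[OF w pq]
      proof
        assume "\<exists>t u y. child p q t u \<and> y \<in> hst_sem run_hst t (hedge \<Sigma> w) \<and> x = u @ y"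
        then obtain t u y where *: "child p q t u" "y \<in> hst_sem run_hst t (hedge \<Sigma> w)" "x = u @ y"
          by blast
        from *(1) show "x \<in> hst_sem run_hst (Some (p, q)) (hedge \<Sigma> w)"
          by cases (use *(2,3) h in \<open>simp_all add: run_hst_sem_None_node del: hst_sem.simps\<close>)
      next
        assume "x \<in> hst_sem run_hst (Some (p, q)) (hedge \<Sigma> w)"
        moreover have "x = [] @ x" by simp
        ultimately show "\<exists>t u y. child p q t u \<and> y \<in> hst_sem run_hst t (hedge \<Sigma> w) \<and> x = u @ y"
          using inner by blast
      qed
    qed
    then show ?thesis
      unfolding vpt_rel_enc[OF vpt w] by (auto simp: hst_rel_def run_hst_def)
  qed
  then show ?thesis by (auto simp: precomp_def)
qed

end

section \<open>From hedge transducers to transducers on encodings\<close>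

text \<open>A stack symbol prescribes completely what the matching return does. Since it also
  records the output of the call, well-nestedness of the transducer becomes a condition on single
  frames.\<close>

datatype ('k, 'a, 'b) frame =
  Frame (call_output: "'b list") (pop_letter: 'a) (pop_output: "'b list") (pop_target: "'k list")

text \<open>The bound \<open>N\<close> on the words in rules makes the sets of tasks and frames
  below finite.\<close>

locale hst_to_fcns = fcns_alphabet \<Sigma> bc br for \<Sigma> :: "'a salphabet" and bc br :: 'a +
  fixes \<Delta> :: "'b salphabet" and T :: "('t, 'a \<times> 'a, 'b) hst" and N :: nat
  assumes delta: "structured_alphabet \<Delta>"
    and hst: "is_hst (calls \<Sigma> \<times> rets \<Sigma>) (syms \<Delta>) T"
    and h2h: "hedge_to_hedge \<Delta> T"
    and bound: "Node_rule q f w1 q1 w2 q2 w3 \<in> hrules T \<Longrightarrow>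
      length w1 \<le> N \<and> length w2 \<le> N \<and> length w3 \<le> N"
begin

definition words :: "nat \<Rightarrow> 'b list set" where
  "words n = {w. set w \<subseteq> syms \<Delta> \<and> length w \<le> n}"

text \<open>A task \<open>(q, a, b)\<close> is to output \<open>a s b\<close> for some \<open>s\<close> that \<open>q\<close> produces on the next
  subhedge. A state is the list of tasks left on the current level of nesting.\<close>

definition tasks :: "('t \<times> 'b list \<times> 'b list) set" where
  "tasks = {(q, a, b). q \<in> hstates T \<and> a \<in> words N \<and> b \<in> words N \<and> a @ b \<in> well_nested \<Delta>}"

text \<open>Length 2 suffices because a node opens a level with one task for each of its two
  subhedges.\<close>

definition agendas :: "('t \<times> 'b list \<times> 'b list) list set" where
  "agendas = {ts. set ts \<subseteq> tasks \<and> length ts \<le> 2}"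

text \<open>The bound is \<open>2 * N\<close> because a word from a rule is joined to a word from
  the current task.\<close>

definition frames :: "('t \<times> 'b list \<times> 'b list, 'a, 'b) frame set" where
  "frames = {g. call_output g \<in> words (2 * N) \<and> pop_letter g \<in> rets \<Sigma>' \<and>
     pop_output g \<in> words (2 * N) \<and> call_output g @ pop_output g \<in> well_nested \<Delta> \<and>
     pop_target g \<in> agendas}"

text \<open>By \<open>wn_split_total\<close> a rule of \<open>T\<close> splits into three well-nested pairs of words: one around
  both subhedges, and one around each of them.\<close>

inductive_set task_calls where
  leaf: "Empty_rule q \<in> hrules T \<Longrightarrow> (q, a, b) # ts \<in> agendas \<Longrightarrow>
    ((q, a, b) # ts, bc, Frame a br b ts, a, []) \<in> task_calls"
| node: "Node_rule q (c, r) (a1 @ b1) q1 (c1 @ d1) q2 (e1 @ f1) \<in> hrules T \<Longrightarrow>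
    a1 @ f1 \<in> well_nested \<Delta> \<Longrightarrow> b1 @ c1 \<in> well_nested \<Delta> \<Longrightarrow> d1 @ e1 \<in> well_nested \<Delta> \<Longrightarrow>
    (q, a, b) # ts \<in> agendas \<Longrightarrow>
    ((q, a, b) # ts, c, Frame (a @ a1) r (f1 @ b) ts, a @ a1, [(q1, b1, c1), (q2, d1, e1)]) \<in> task_calls"

text \<open>A return leaves the empty agenda only, that is, after all tasks of the level are done,
  and resumes the agenda stored in the frame.\<close>

definition task_rets where
  "task_rets = (\<lambda>g. ([], pop_letter g, g, pop_output g, pop_target g)) ` frames"

text \<open>The bottom symbol has three tasks, so it is not a frame.\<close>

definition task_vpt where
  "task_vpt = \<lparr>vstates = agendas, vinit = (\<lambda>q. [(q, [], [])]) ` hinit T, vfinal = {[]},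
     vstack = frames, vbottom = Frame [] br [] (replicate 3 undefined),
     vcalls = task_calls, vrets = task_rets\<rparr>"

lemma node_rule:
  assumes "Node_rule q f w1 q1 w2 q2 w3 \<in> hrules T"
  shows "q1 \<in> hstates T" "q2 \<in> hstates T" "f \<in> calls \<Sigma> \<times> rets \<Sigma>"
    "w1 \<in> words N" "w2 \<in> words N" "w3 \<in> words N"
proof -
  have *: "q1 \<in> hstates T \<and> q2 \<in> hstates T \<and> f \<in> calls \<Sigma> \<times> rets \<Sigma> \<and>
      w1 \<in> lists (syms \<Delta>) \<and> w2 \<in> lists (syms \<Delta>) \<and> w3 \<in> lists (syms \<Delta>)"
    using hst assms unfolding is_hst_def by blast
  then show "q1 \<in> hstates T" "q2 \<in> hstates T" "f \<in> calls \<Sigma> \<times> rets \<Sigma>" by blast+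
  show "w1 \<in> words N" "w2 \<in> words N" "w3 \<in> words N"
    using * bound[OF assms] by (auto simp: words_def)
qed

lemma words_append: "u @ v \<in> words n \<Longrightarrow> u \<in> words n \<and> v \<in> words n"
  by (auto simp: words_def)

lemma append_words: "u \<in> words N \<Longrightarrow> v \<in> words N \<Longrightarrow> u @ v \<in> words (2 * N)"
  by (auto simp: words_def)

lemma words_mono: "u \<in> words N \<Longrightarrow> u \<in> words (2 * N)"
  by (auto simp: words_def)

lemma agendas_tl: "t # ts \<in> agendas \<Longrightarrow> ts \<in> agendas"
  by (auto simp: agendas_def)

lemma agendas_hd: "t # ts \<in> agendas \<Longrightarrow> t \<in> tasks"
  by (auto simp: agendas_def)

lemma finite_words: "finite (words n)"
  using delta finite_lists_length_le[of "syms \<Delta>" n]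
  by (simp add: words_def structured_alphabet_def)

lemma finite_agendas: "finite agendas"
proof -
  have "tasks \<subseteq> hstates T \<times> words N \<times> words N" by (auto simp: tasks_def)
  moreover have "finite (hstates T)" using hst by (simp add: is_hst_def)
  ultimately have "finite tasks"
    using finite_words by (auto intro: finite_subset)
  then show ?thesis unfolding agendas_def by (rule finite_lists_length_le)
qed

lemma Frame_in_frames [simp]:
  "Frame v r v' ts \<in> frames \<longleftrightarrow> v \<in> words (2 * N) \<and> r \<in> rets \<Sigma>' \<and> v' \<in> words (2 * N) \<and>
     v @ v' \<in> well_nested \<Delta> \<and> ts \<in> agendas"
  by (auto simp: frames_def)

lemma finite_frames: "finite frames"
proof -
  let ?F = "\<lambda>(v, r, v', ts). Frame v r v' ts"
  have "frames \<subseteq> ?F ` (words (2 * N) \<times> rets \<Sigma>' \<times> words (2 * N) \<times> agendas)"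
  proof
    fix g assume "g \<in> frames"
    then have "?F (call_output g, pop_letter g, pop_output g, pop_target g)
        \<in> ?F ` (words (2 * N) \<times> rets \<Sigma>' \<times> words (2 * N) \<times> agendas)"
      unfolding frames_def by (intro imageI) blast
    then show "g \<in> ?F ` (words (2 * N) \<times> rets \<Sigma>' \<times> words (2 * N) \<times> agendas)" by simp
  qed
  moreover have "finite (rets \<Sigma>')" using sigma by (simp add: bot_ext_def structured_alphabet_def)
  ultimately show ?thesis
    using finite_words finite_agendas by (auto elim: finite_subset)
qed

lemma node_agenda:
  assumes "Node_rule q (c, r) (a1 @ b1) q1 (c1 @ d1) q2 (e1 @ f1) \<in> hrules T"
    "b1 @ c1 \<in> well_nested \<Delta>" "d1 @ e1 \<in> well_nested \<Delta>"
  shows "[(q1, b1, c1), (q2, d1, e1)] \<in> agendas"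
  using node_rule(1,2)[OF assms(1)] node_rule(4-6)[OF assms(1), THEN words_append] assms(2,3)
  by (simp add: agendas_def tasks_def)

lemma task_calls_typing:
  assumes "(ts, c, g, v, ts') \<in> task_calls"
  shows "ts \<in> agendas \<and> c \<in> calls \<Sigma>' \<and> g \<in> frames \<and> v \<in> words (2 * N) \<and> ts' \<in> agendas \<and> v = call_output g"
  using assms
proof cases
  case (leaf q b ts)
  moreover have "[] \<in> agendas" by (simp add: agendas_def)
  ultimately show ?thesis
    using agendas_tl[OF leaf(6)] agendas_hd[OF leaf(6)]
    by (simp add: tasks_def bot_ext_def words_mono)
next
  case (node q r a1 b1 q1 c1 d1 q2 e1 f1 a b ts)
  note rule = node_rule[OF node(5)]
  have t: "a \<in> words N" "b \<in> words N" "a @ b \<in> well_nested \<Delta>"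
    using agendas_hd[OF node(9)] by (auto simp: tasks_def)
  \<comment> \<open>The outer pair \<open>(a1, f1)\<close> of the rule is nested inside the pair
    \<open>(a, b)\<close> of the task.\<close>
  have "(a @ a1) @ (f1 @ b) \<in> well_nested \<Delta>"
    using wn_insert[OF t(3) refl node(6)] by simp
  moreover have "a @ a1 \<in> words (2 * N)" "f1 @ b \<in> words (2 * N)"
    using append_words t(1,2) words_append[OF rule(4)] words_append[OF rule(6)] by simp_all
  ultimately show ?thesis
    using node(1-4) rule(3) node_agenda[OF node(5,7,8)] agendas_tl[OF node(9)] node(9)
    by (simp add: bot_ext_def)
qed

lemma task_vpt_is_vpt: "is_vpt \<Sigma>' (syms \<Delta>) task_vpt"
proof -
  \<comment> \<open>Words of bounded length, in place of all of
    \<open>lists (syms \<Delta>)\<close>, make this superset finite.\<close>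
  have calls: "task_calls \<subseteq> agendas \<times> calls \<Sigma>' \<times> frames \<times> words (2 * N) \<times> agendas"
  proof
    fix x assume "x \<in> task_calls"
    then show "x \<in> agendas \<times> calls \<Sigma>' \<times> frames \<times> words (2 * N) \<times> agendas"
      using task_calls_typing by (cases x) blast
  qed
  have "finite (calls \<Sigma>')" using sigma by (simp add: bot_ext_def structured_alphabet_def)
  then have "finite task_calls"
    using finite_subset[OF calls] finite_agendas finite_frames finite_words by simp
  moreover have words: "words (2 * N) \<subseteq> lists (syms \<Delta>)" by (auto simp: words_def)
  then have "task_calls \<subseteq> agendas \<times> calls \<Sigma>' \<times> frames \<times> lists (syms \<Delta>) \<times> agendas"
    using calls by blast
  moreover have "[] \<in> agendas" by (simp add: agendas_def)
  moreover from this words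
  have "task_rets \<subseteq> agendas \<times> rets \<Sigma>' \<times> frames \<times> lists (syms \<Delta>) \<times> agendas"
    by (auto simp: task_rets_def frames_def)
  moreover have "finite task_rets" unfolding task_rets_def using finite_frames by (rule finite_imageI)
  moreover have "[(q, [], [])] \<in> agendas" if "q \<in> hinit T" for q
  proof -
    have "q \<in> hstates T" using that hst unfolding is_hst_def by blast
    then show ?thesis by (simp add: agendas_def tasks_def words_def wn_Nil)
  qed
  moreover have "Frame [] br [] (replicate 3 undefined) \<notin> frames"
    by (simp add: agendas_def)
  ultimately show ?thesis
    using finite_agendas finite_frames
    unfolding is_vpt_def by (simp add: task_vpt_def image_subset_iff)
qed

lemma task_vpt_well_nested: "well_nested_vpt \<Delta> task_vpt"
  unfolding well_nested_vpt_def
proof (intro ballI allI impI)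
  fix g q c v q' p r v' p'
  assume "(q, c, g, v, q') \<in> vcalls task_vpt" "(p, r, g, v', p') \<in> vrets task_vpt"
  then have "v = call_output g" "g \<in> frames" "v' = pop_output g"
    using task_calls_typing by (auto simp: task_vpt_def task_rets_def)
  then show "v @ v' \<in> well_nested \<Delta>" by (simp add: frames_def)
qed

lemma task_rets_iff:
  "(ts', r', Frame v r v' ts, x, ts'') \<in> task_rets \<longleftrightarrow>
    ts' = [] \<and> r' = r \<and> x = v' \<and> ts'' = ts \<and> Frame v r v' ts \<in> frames"
  by (force simp: task_rets_def simp del: Frame_in_frames)

lemma vpt_sel: "vcalls task_vpt = task_calls" "vrets task_vpt = task_rets"
  by (simp_all add: task_vpt_def)

text \<open>Reading one encoded hedge performs exactly the first task: the call stores
  \<open>ts\<close> in its frame and opens a fresh agenda for the two subhedges, the induction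
  hypotheses empty that agenda, and the return restores \<open>ts\<close>.\<close>

lemma balanced_run_task_vpt:
  assumes "w \<in> well_nested \<Sigma>" "(q, a, b) # ts \<in> agendas"
  shows "balanced_run task_vpt ((q, a, b) # ts) (enc w) x ts' \<longleftrightarrow>
    ts' = ts \<and> (\<exists>s\<in>hst_sem T q (hedge \<Sigma> w). x = a @ s @ b)"
  using assms
proof (induction arbitrary: q a b ts x ts' rule: wn_induct)
  case Nil
  have sem: "(\<exists>s\<in>hst_sem T q (hedge \<Sigma> []). x = a @ s @ b) \<longleftrightarrow>
      Empty_rule q \<in> hrules T \<and> x = a @ b"
    by (simp add: hedge_Nil[OF sigma])
  show ?case
    unfolding balanced_run_enc_Nil[OF task_vpt_is_vpt] vpt_sel sem
  proof
    assume "\<exists>g v p1 v'. ((q, a, b) # ts, bc, g, v, p1) \<in> task_calls \<and>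
        (p1, br, g, v', ts') \<in> task_rets \<and> x = v @ v'"
    then obtain g v p1 v' where *: "((q, a, b) # ts, bc, g, v, p1) \<in> task_calls"
      "(p1, br, g, v', ts') \<in> task_rets" "x = v @ v'"
      by blast
    from *(1) show "ts' = ts \<and> Empty_rule q \<in> hrules T \<and> x = a @ b"
    proof cases
      case leaf
      then show ?thesis using *(2,3) by (simp add: task_rets_iff)
    next
      \<comment> \<open>Such a transition reads a call of \<open>\<Sigma>\<close>, whereas
        \<open>bc\<close> is fresh.\<close>
      case (node r)
      then show ?thesis using node_rule(3) fresh by blast
    qed
  next
    assume "ts' = ts \<and> Empty_rule q \<in> hrules T \<and> x = a @ b"
    then have *: "((q, a, b) # ts, bc, Frame a br b ts, a, []) \<in> task_calls" "x = a @ b" "ts' = ts"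
      using Nil task_calls.leaf by blast+
    moreover have "([], br, Frame a br b ts, b, ts') \<in> task_rets"
      using task_calls_typing[OF *(1)] *(3) by (simp add: task_rets_iff)
    ultimately show "\<exists>g v p1 v'. ((q, a, b) # ts, bc, g, v, p1) \<in> task_calls \<and>
        (p1, br, g, v', ts') \<in> task_rets \<and> x = v @ v'"
      by blast
  qed
next
  case (node c r w1 w2)
  let ?h = "hedge \<Sigma>"
  show ?case
  proof
    assume "balanced_run task_vpt ((q, a, b) # ts) (enc (c # w1 @ r # w2)) x ts'"
    then obtain g v p1 y1 m y2 p2 v' where
      *: "((q, a, b) # ts, c, g, v, p1) \<in> task_calls" "balanced_run task_vpt p1 (enc w1) y1 m"
        "balanced_run task_vpt m (enc w2) y2 p2" "(p2, r, g, v', ts') \<in> task_rets"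
        "x = v @ (y1 @ y2) @ v'"
      unfolding balanced_run_enc_node[OF task_vpt_is_vpt node.hyps] vpt_sel by blast
    from *(1) show "ts' = ts \<and> (\<exists>s\<in>hst_sem T q (?h (c # w1 @ r # w2)). x = a @ s @ b)"
    proof cases
      case leaf
      then show ?thesis using node.hyps(1) fresh by blast
    next
      case (node r' a1 b1 q1 c1 d1 q2 e1 f1)
      note ag = node_agenda[OF node(4,6,7)]
      obtain s1 where 1: "m = [(q2, d1, e1)]" "s1 \<in> hst_sem T q1 (?h w1)" "y1 = b1 @ s1 @ c1"
        using *(2) unfolding node(3) node.IH(1)[OF ag] by blast
      \<comment> \<open>The first subhedge has consumed its task, so the second one starts with the
        tail of the agenda.\<close>
      obtain s2 where 2: "p2 = []" "s2 \<in> hst_sem T q2 (?h w2)" "y2 = d1 @ s2 @ e1"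
        using *(3) unfolding 1(1) node.IH(2)[OF agendas_tl[OF ag]] by blast
      have 3: "r' = r" "v' = f1 @ b" "ts' = ts"
        using *(4) unfolding node(1) task_rets_iff by auto
      have "(a1 @ b1) @ s1 @ (c1 @ d1) @ s2 @ (e1 @ f1) \<in> hst_sem T q (Tree (c, r) (?h w1) # ?h w2)"
        using node(4) 1(2) 2(2) 3(1) unfolding hst_sem.simps by blast
      moreover have "x = a @ ((a1 @ b1) @ s1 @ (c1 @ d1) @ s2 @ (e1 @ f1)) @ b"
        using *(5) node(2) 1(3) 2(3) 3(2) by simp
      ultimately show ?thesis
        using 3(3) unfolding hedge_node[OF sigma node.hyps] by blast
    qed
  next
    assume "ts' = ts \<and> (\<exists>s\<in>hst_sem T q (?h (c # w1 @ r # w2)). x = a @ s @ b)"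
    then obtain u1 q1 u2 q2 u3 s1 s2 where
      *: "ts' = ts" "Node_rule q (c, r) u1 q1 u2 q2 u3 \<in> hrules T"
        "s1 \<in> hst_sem T q1 (?h w1)" "s2 \<in> hst_sem T q2 (?h w2)"
        "x = a @ (u1 @ s1 @ u2 @ s2 @ u3) @ b"
      unfolding hedge_node[OF sigma node.hyps] hst_sem.simps by blast
    have "u1 @ u2 @ u3 \<in> well_nested \<Delta>" using h2h *(2) unfolding hedge_to_hedge_def by blast
    \<comment> \<open>The split of the rule determines the call transition to take, and the two
      inner pairs become the tasks of the subhedges.\<close>
    from wn_split_total[OF this refl]
    show "balanced_run task_vpt ((q, a, b) # ts) (enc (c # w1 @ r # w2)) x ts'"
    proof cases
      case (wn_splitI a1 f1 b1 c1 d1 e1)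
      note rule = *(2)[unfolded wn_splitI(1-3)]
      note ag = node_agenda[OF rule wn_splitI(5,6)]
      have call: "((q, a, b) # ts, c, Frame (a @ a1) r (f1 @ b) ts, a @ a1, [(q1, b1, c1), (q2, d1, e1)])
          \<in> task_calls"
        using task_calls.node[OF rule wn_splitI(4-6) node.prems] .
      have "balanced_run task_vpt [(q1, b1, c1), (q2, d1, e1)] (enc w1) (b1 @ s1 @ c1) [(q2, d1, e1)]"
        using *(3) unfolding node.IH(1)[OF ag] by blast
      moreover have "balanced_run task_vpt [(q2, d1, e1)] (enc w2) (d1 @ s2 @ e1) []"
        using *(4) unfolding node.IH(2)[OF agendas_tl[OF ag]] by blast
      moreover have "([], r, Frame (a @ a1) r (f1 @ b) ts, f1 @ b, ts') \<in> task_rets"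
        using task_calls_typing[OF call] *(1) by (simp add: task_rets_iff)
      moreover have "x = (a @ a1) @ ((b1 @ s1 @ c1) @ (d1 @ s2 @ e1)) @ (f1 @ b)"
        using *(5) wn_splitI(1-3) by simp
      ultimately show ?thesis
        unfolding balanced_run_enc_node[OF task_vpt_is_vpt node.hyps] vpt_sel using call by blast
    qed
  qed
qed

lemma task_vpt_rel:
  assumes "w \<in> well_nested \<Sigma>"
  shows "(enc w, x) \<in> vpt_rel task_vpt \<longleftrightarrow> (hedge \<Sigma> w, x) \<in> hst_rel T"
proof -
  have "balanced_run task_vpt [(q, [], [])] (enc w) x [] \<longleftrightarrow> x \<in> hst_sem T q (hedge \<Sigma> w)"
    if "q \<in> hinit T" for q
  proof -
    have "[(q, [], [])] \<in> agendas"
      using that task_vpt_is_vpt unfolding is_vpt_def by (auto simp: task_vpt_def)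
    from balanced_run_task_vpt[OF assms this] show ?thesis by simp
  qed
  then show ?thesis
    unfolding vpt_rel_enc[OF task_vpt_is_vpt assms] by (simp add: hst_rel_def task_vpt_def)
qed

end

text \<open>Provides the parameter \<open>N\<close> of \<open>hst_to_fcns\<close>.\<close>

lemma hst_rule_bound:
  assumes "is_hst \<Lambda> D T"
  shows "\<exists>N. \<forall>q f w1 q1 w2 q2 w3. Node_rule q f w1 q1 w2 q2 w3 \<in> hrules T \<longrightarrow>
    length w1 \<le> N \<and> length w2 \<le> N \<and> length w3 \<le> N"
proof -
  let ?len = "\<lambda>\<rho>. case \<rho> of Empty_rule _ \<Rightarrow> 0
    | Node_rule q f w1 q1 w2 q2 w3 \<Rightarrow> length w1 + length w2 + length w3"
  have "finite (?len ` hrules T)" using assms by (simp add: is_hst_def)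
  then obtain N where N: "\<And>n. n \<in> ?len ` hrules T \<Longrightarrow> n \<le> N"
    unfolding finite_nat_set_iff_bounded_le by blast
  have "length w1 + length w2 + length w3 \<le> N"
    if "Node_rule q f w1 q1 w2 q2 w3 \<in> hrules T" for q f w1 q1 w2 q2 w3
    using N[OF imageI[OF that]] by simp
  then show ?thesis by (intro exI[of _ N]) fastforce
qed

section \<open>Renaming states and stack symbols\<close>

text \<open>The theorem asks for transducers over \<open>nat\<close>, whereas the constructions
  yield optional pairs, agendas and frames; their finite carriers inject into
  \<open>nat\<close>.\<close>

definition rename_vpt ::
  "('s \<Rightarrow> 's2) \<Rightarrow> ('g \<Rightarrow> 'g2) \<Rightarrow> ('s, 'g, 'a, 'b) vpt \<Rightarrow> ('s2, 'g2, 'a, 'b) vpt" where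
  "rename_vpt f h A = \<lparr>vstates = f ` vstates A, vinit = f ` vinit A, vfinal = f ` vfinal A,
     vstack = h ` vstack A, vbottom = h (vbottom A),
     vcalls = (\<lambda>(q, a, g, v, q'). (f q, a, h g, v, f q')) ` vcalls A,
     vrets = (\<lambda>(q, a, g, v, q'). (f q, a, h g, v, f q')) ` vrets A\<rparr>"

lemma rename_vpt_run:
  "vpt_run A k u v k' \<Longrightarrow> vpt_run (rename_vpt f h A) (map_prod f (map h) k) u v (map_prod f (map h) k')"
proof (induction rule: vpt_run.induct)
  case (run_Nil k)
  then show ?case by (rule vpt_run.run_Nil)
next
  case (run_call q a g v q' s u x k)
  then have "(f q, a, h g, v, f q') \<in> vcalls (rename_vpt f h A)"
    by (force simp: rename_vpt_def)
  from vpt_run.run_call[OF this] run_call.IH show ?case by simp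
next
  case (run_ret q a g v q' s u x k)
  then have "(f q, a, h g, v, f q') \<in> vrets (rename_vpt f h A)"
    by (force simp: rename_vpt_def)
  from vpt_run.run_ret[OF this] run_ret.IH show ?case by simp
qed

text \<open>Valid for arbitrary \<open>f\<close> and \<open>h\<close>. For injective renamings the
  reverse inclusion is this same lemma applied to the inverse renaming, by
  \<open>rename_vpt_ident\<close>.\<close>

lemma rename_vpt_rel_mono: "vpt_rel A \<subseteq> vpt_rel (rename_vpt f h A)"
proof clarify
  fix u v assume "(u, v) \<in> vpt_rel A"
  then obtain q q' where *: "q \<in> vinit A" "q' \<in> vfinal A"
    "vpt_run A (q, [vbottom A]) u v (q', [vbottom A])"
    by (auto simp: vpt_rel_def)
  from rename_vpt_run[OF *(3), of f h] *(1,2) show "(u, v) \<in> vpt_rel (rename_vpt f h A)"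
    by (auto simp: vpt_rel_def rename_vpt_def)
qed

lemma image_ident_on: "(\<And>x. x \<in> X \<Longrightarrow> f x = x) \<Longrightarrow> f ` X = X"
  by force

lemma rename_vpt_ident:
  assumes "is_vpt \<Sigma> D A" "\<And>q. q \<in> vstates A \<Longrightarrow> f' (f q) = q"
    "\<And>g. g \<in> insert (vbottom A) (vstack A) \<Longrightarrow> h' (h g) = g"
  shows "rename_vpt f' h' (rename_vpt f h A) = A"
proof -
  have sub: "vinit A \<subseteq> vstates A" "vfinal A \<subseteq> vstates A"
    using assms(1) by (auto simp: is_vpt_def)
  have trans: "(q, a, g, v, q') \<in> vcalls A \<union> vrets A \<Longrightarrow>
      q \<in> vstates A \<and> g \<in> vstack A \<and> q' \<in> vstates A" for q a g v q'
    using assms(1) unfolding is_vpt_def by blast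
  have "(\<lambda>(q, a, g, v, q'). (f' (f q), a, h' (h g), v, f' (f q'))) ` X = X"
    if "X \<subseteq> vcalls A \<union> vrets A" for X
  proof (rule image_ident_on)
    fix x assume "x \<in> X"
    moreover obtain q a g v q' where x: "x = (q, a, g, v, q')" by (cases x)
    ultimately have "q \<in> vstates A \<and> g \<in> vstack A \<and> q' \<in> vstates A"
      using trans[of q a g v q'] that by blast
    then show "(\<lambda>(q, a, g, v, q'). (f' (f q), a, h' (h g), v, f' (f q'))) x = x"
      unfolding x using assms(2,3) by simp
  qed
  then have trans_image:
    "(\<lambda>(q, a, g, v, q'). (f' (f q), a, h' (h g), v, f' (f q'))) ` vcalls A = vcalls A"
    "(\<lambda>(q, a, g, v, q'). (f' (f q), a, h' (h g), v, f' (f q'))) ` vrets A = vrets A"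
    by blast+
  have "(\<lambda>q. f' (f q)) ` X = X" if "X \<subseteq> vstates A" for X
    using that assms(2) by (intro image_ident_on) blast
  then have "(\<lambda>q. f' (f q)) ` vstates A = vstates A" "(\<lambda>q. f' (f q)) ` vinit A = vinit A"
    "(\<lambda>q. f' (f q)) ` vfinal A = vfinal A"
    using sub by blast+
  moreover have "(\<lambda>g. h' (h g)) ` vstack A = vstack A"
    using assms(3) by (intro image_ident_on) blast
  ultimately show ?thesis
    using trans_image assms(3)
    by (cases A) (simp add: rename_vpt_def image_image case_prod_unfold)
qed

lemma nat_vpt:
  assumes "is_vpt \<Sigma> D A" "well_nested_vpt \<Delta> A"
  obtains B :: "(nat, nat, 'a, 'b) vpt"
  where "is_vpt \<Sigma> D B" "well_nested_vpt \<Delta> B" "vpt_rel B = vpt_rel A"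
proof -
  have fin: "finite (vstates A)" "finite (insert (vbottom A) (vstack A))"
    using assms(1) by (simp_all add: is_vpt_def)
  obtain f :: "_ \<Rightarrow> nat" where f: "inj_on f (vstates A)"
    using finite_imp_inj_to_nat_seg[OF fin(1)] by blast
  \<comment> \<open>Injectivity includes the bottom symbol, whose image must stay outside the
    renamed stack alphabet.\<close>
  obtain h :: "_ \<Rightarrow> nat" where h: "inj_on h (insert (vbottom A) (vstack A))"
    using finite_imp_inj_to_nat_seg[OF fin(2)] by blast
  let ?B = "rename_vpt f h A"
  let ?f = "inv_into (vstates A) f" and ?h = "inv_into (insert (vbottom A) (vstack A)) h"
  have inv: "rename_vpt ?f ?h ?B = A"
    using f h by (intro rename_vpt_ident[OF assms(1)] inv_into_f_f)
  have "vpt_rel ?B = vpt_rel A"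
    using rename_vpt_rel_mono[of A f h] rename_vpt_rel_mono[of ?B ?f ?h] unfolding inv by blast
  moreover have "h (vbottom A) \<notin> h ` vstack A"
    using h assms(1) unfolding is_vpt_def by auto
  then have "is_vpt \<Sigma> D ?B"
    using assms(1) unfolding is_vpt_def by (force simp: rename_vpt_def)
  moreover have "well_nested_vpt \<Delta> ?B"
    unfolding well_nested_vpt_def
  proof (intro ballI allI impI)
    fix k q c v q' p r v' p'
    assume "(q, c, k, v, q') \<in> vcalls ?B" "(p, r, k, v', p') \<in> vrets ?B"
    then obtain q0 g q0' p0 g' p0' where *: "(q0, c, g, v, q0') \<in> vcalls A"
      "(p0, r, g', v', p0') \<in> vrets A" "h g = h g'"
      by (auto simp: rename_vpt_def)
    have "g \<in> vstack A" "g' \<in> vstack A" using *(1,2) assms(1) unfolding is_vpt_def by blast+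
    \<comment> \<open>Injectivity ensures that only transitions matching in \<open>A\<close> match
      after renaming.\<close>
    with h *(3) have "g = g'" by (auto dest: inj_onD)
    with * \<open>g \<in> vstack A\<close> show "v @ v' \<in> well_nested \<Delta>"
      using assms(2) unfolding well_nested_vpt_def by blast
  qed
  ultimately show thesis using that by blast
qed

section \<open>Renaming the states of hedge transducers\<close>

definition rename_hst :: "('s \<Rightarrow> 's2) \<Rightarrow> ('s, 'f, 'b) hst \<Rightarrow> ('s2, 'f, 'b) hst" where
  "rename_hst f T = \<lparr>hstates = f ` hstates T, hinit = f ` hinit T,
     hrules = map_hrule f id id ` hrules T\<rparr>"

lemma rename_hst_rules:
  "Empty_rule p \<in> hrules (rename_hst f T) \<longleftrightarrow> (\<exists>q. p = f q \<and> Empty_rule q \<in> hrules T)"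
  "Node_rule p a w1 p1 w2 p2 w3 \<in> hrules (rename_hst f T) \<longleftrightarrow>
    (\<exists>q q1 q2. p = f q \<and> p1 = f q1 \<and> p2 = f q2 \<and> Node_rule q a w1 q1 w2 q2 w3 \<in> hrules T)"
proof -
  have *: "Empty_rule p = map_hrule f id id \<rho> \<longleftrightarrow> (\<exists>q. \<rho> = Empty_rule q \<and> p = f q)"
    "Node_rule p a w1 p1 w2 p2 w3 = map_hrule f id id \<rho> \<longleftrightarrow>
      (\<exists>q q1 q2. \<rho> = Node_rule q a w1 q1 w2 q2 w3 \<and> p = f q \<and> p1 = f q1 \<and> p2 = f q2)" for \<rho>
    by (cases \<rho>; auto)+
  show "Empty_rule p \<in> hrules (rename_hst f T) \<longleftrightarrow> (\<exists>q. p = f q \<and> Empty_rule q \<in> hrules T)"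
    by (auto simp: rename_hst_def image_iff *)
  show "Node_rule p a w1 p1 w2 p2 w3 \<in> hrules (rename_hst f T) \<longleftrightarrow>
    (\<exists>q q1 q2. p = f q \<and> p1 = f q1 \<and> p2 = f q2 \<and> Node_rule q a w1 q1 w2 q2 w3 \<in> hrules T)"
    by (auto simp: rename_hst_def image_iff *)
qed

lemma rename_hst_sem: "s \<in> hst_sem T q h \<Longrightarrow> s \<in> hst_sem (rename_hst f T) (f q) h"
proof (induction T q h arbitrary: s rule: hst_sem.induct[case_names Nil Cons])
  case (Nil T q)
  then show ?case by (auto simp: rename_hst_rules split: if_splits)
next
  case (Cons T q a h h')
  then obtain w1 q1 w2 q2 w3 s1 s2 where *: "Node_rule q a w1 q1 w2 q2 w3 \<in> hrules T"
    "s1 \<in> hst_sem T q1 h" "s2 \<in> hst_sem T q2 h'" "s = w1 @ s1 @ w2 @ s2 @ w3"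
    by auto
  have "Node_rule (f q) a w1 (f q1) w2 (f q2) w3 \<in> hrules (rename_hst f T)"
    using *(1) rename_hst_rules(2) by metis
  moreover have "s1 \<in> hst_sem (rename_hst f T) (f q1) h" "s2 \<in> hst_sem (rename_hst f T) (f q2) h'"
    using Cons.IH *(2,3) by blast+
  ultimately show ?case using *(4) unfolding hst_sem.simps by blast
qed

lemma rename_hst_rel_mono: "hst_rel T \<subseteq> hst_rel (rename_hst f T)"
  using rename_hst_sem by (fastforce simp: hst_rel_def rename_hst_def)

lemma rename_hst_ident:
  assumes "is_hst \<Lambda> D T" "\<And>q. q \<in> hstates T \<Longrightarrow> f' (f q) = q"
  shows "rename_hst f' (rename_hst f T) = T"
proof -
  have "map_hrule f' id id (map_hrule f id id \<rho>) = \<rho>" if "\<rho> \<in> hrules T" for \<rho>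
    using that assms unfolding is_hst_def by (cases \<rho>) auto
  then show ?thesis
    using assms by (cases T) (auto simp: rename_hst_def is_hst_def image_image intro!: image_ident_on)
qed

lemma nat_hst:
  assumes "is_hst \<Lambda> D T" "hedge_to_hedge \<Delta> T"
  obtains U :: "(nat, 'f, 'b) hst"
  where "is_hst \<Lambda> D U" "hedge_to_hedge \<Delta> U" "hst_rel U = hst_rel T"
proof -
  have fin: "finite (hstates T)" using assms(1) by (simp add: is_hst_def)
  obtain f :: "_ \<Rightarrow> nat" where f: "inj_on f (hstates T)"
    using finite_imp_inj_to_nat_seg[OF fin] by blast
  let ?U = "rename_hst f T"
  let ?f = "inv_into (hstates T) f"
  have inv: "rename_hst ?f ?U = T"
    using f by (intro rename_hst_ident[OF assms(1)] inv_into_f_f)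
  have "hst_rel ?U = hst_rel T"
    using rename_hst_rel_mono[of T f] rename_hst_rel_mono[of ?U ?f] unfolding inv by blast
  moreover have "finite (hstates ?U)" "finite (hrules ?U)" "hinit ?U \<subseteq> hstates ?U"
    using assms(1) by (auto simp: is_hst_def rename_hst_def)
  moreover have "hstates ?U = f ` hstates T" by (simp add: rename_hst_def)
  ultimately have "is_hst \<Lambda> D ?U"
    using assms(1) unfolding is_hst_def by (simp add: rename_hst_rules) blast
  moreover have "hedge_to_hedge \<Delta> ?U"
    using assms(2) unfolding hedge_to_hedge_def by (simp add: rename_hst_rules) blast
  ultimately show thesis using that \<open>hst_rel ?U = hst_rel T\<close> by blast
qed

theorem lemma6:
  fixes \<Sigma> :: "'a salphabet" and \<Delta> :: "'b salphabet" and bc br :: 'a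
  assumes "structured_alphabet \<Sigma>" and "structured_alphabet \<Delta>"
    and "bc \<notin> syms \<Sigma>" and "br \<notin> syms \<Sigma>" and "bc \<noteq> br"
  shows "(\<forall>A :: ('s, 'g, 'a, 'b) vpt.
           is_vpt (bot_ext \<Sigma> bc br) (syms \<Delta>) A \<and> well_nested_vpt \<Delta> A \<and>
           \<not> accepts (vpt_rel A) (fcns \<Sigma> bc br []) \<longrightarrow>
           (\<exists>T :: (nat, 'a \<times> 'a, 'b) hst.
              is_hst (calls \<Sigma> \<times> rets \<Sigma>) (syms \<Delta>) T \<and> hedge_to_hedge \<Delta> T \<and>
              \<not> accepts (hst_rel T) [] \<and>
              precomp (vpt_rel A) (fcns \<Sigma> bc br) (well_nested \<Sigma>) =
              precomp (hst_rel T) (hedge \<Sigma>) (well_nested \<Sigma>)))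
         \<and>
         (\<forall>T :: ('t, 'a \<times> 'a, 'b) hst.
           is_hst (calls \<Sigma> \<times> rets \<Sigma>) (syms \<Delta>) T \<and> hedge_to_hedge \<Delta> T \<and>
           \<not> accepts (hst_rel T) [] \<longrightarrow>
           (\<exists>A :: (nat, nat, 'a, 'b) vpt.
              is_vpt (bot_ext \<Sigma> bc br) (syms \<Delta>) A \<and> well_nested_vpt \<Delta> A \<and>
              \<not> accepts (vpt_rel A) [bc, br] \<and>
              precomp (vpt_rel A) (fcns \<Sigma> bc br) (well_nested \<Sigma>) =
              precomp (hst_rel T) (hedge \<Sigma>) (well_nested \<Sigma>)))"
proof (intro conjI allI impI; elim conjE)
  interpret fcns_alphabet \<Sigma> bc br using assms by unfold_locales
  fix A :: "('s, 'g, 'a, 'b) vpt"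
  assume A: "is_vpt \<Sigma>' (syms \<Delta>) A" "well_nested_vpt \<Delta> A" "\<not> accepts (vpt_rel A) (enc [])"
  interpret vpt_on_fcns \<Sigma> bc br \<Delta> A using A(1) by unfold_locales
  obtain T :: "(nat, 'a \<times> 'a, 'b) hst" where T: "is_hst (calls \<Sigma> \<times> rets \<Sigma>) (syms \<Delta>) T"
    "hedge_to_hedge \<Delta> T" "hst_rel T = hst_rel run_hst"
    using nat_hst[OF run_hst_is_hst run_hst_hedge_to_hedge[OF A(2)]] by blast
  show "\<exists>T :: (nat, 'a \<times> 'a, 'b) hst.
      is_hst (calls \<Sigma> \<times> rets \<Sigma>) (syms \<Delta>) T \<and> hedge_to_hedge \<Delta> T \<and>
      \<not> accepts (hst_rel T) [] \<and>
      precomp (vpt_rel A) enc (well_nested \<Sigma>) = precomp (hst_rel T) (hedge \<Sigma>) (well_nested \<Sigma>)"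
    using T(1,2) run_hst_accepts_Nil run_hst_precomp[OF A(3)]
    unfolding T(3)[symmetric] by blast
next
  interpret fcns_alphabet \<Sigma> bc br using assms by unfold_locales
  fix T :: "('t, 'a \<times> 'a, 'b) hst"
  assume T: "is_hst (calls \<Sigma> \<times> rets \<Sigma>) (syms \<Delta>) T" "hedge_to_hedge \<Delta> T"
    "\<not> accepts (hst_rel T) []"
  obtain N where "\<forall>q f w1 q1 w2 q2 w3. Node_rule q f w1 q1 w2 q2 w3 \<in> hrules T \<longrightarrow>
      length w1 \<le> N \<and> length w2 \<le> N \<and> length w3 \<le> N"
    using hst_rule_bound[OF T(1)] by blast
  then interpret hst_to_fcns \<Sigma> bc br \<Delta> T N using assms(2) T(1,2) by unfold_locales blast+
  obtain A :: "(nat, nat, 'a, 'b) vpt" where A: "is_vpt \<Sigma>' (syms \<Delta>) A"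
    "well_nested_vpt \<Delta> A" "vpt_rel A = vpt_rel task_vpt"
    using nat_vpt[OF task_vpt_is_vpt task_vpt_well_nested] by blast
  have "precomp (vpt_rel A) enc (well_nested \<Sigma>) = precomp (hst_rel T) (hedge \<Sigma>) (well_nested \<Sigma>)"
    using task_vpt_rel by (auto simp: precomp_def A(3))
  \<comment> \<open>\<open>[bc, br]\<close> encodes the empty word, whose hedge is empty, so the
    assumption on \<open>T\<close> applies.\<close>
  moreover have "\<not> accepts (vpt_rel A) [bc, br]"
    using task_vpt_rel[OF wn_Nil] T(3)
    by (simp add: accepts_def A(3) fcns_Nil[OF sigma] hedge_Nil[OF sigma])
  ultimately show "\<exists>A :: (nat, nat, 'a, 'b) vpt.
      is_vpt \<Sigma>' (syms \<Delta>) A \<and> well_nested_vpt \<Delta> A \<and> \<not> accepts (vpt_rel A) [bc, br] \<and>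
      precomp (vpt_rel A) enc (well_nested \<Sigma>) = precomp (hst_rel T) (hedge \<Sigma>) (well_nested \<Sigma>)"
    using A(1,2) by blast
qed

end
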